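(* For each integer $d \ge 2$ there exists a body $B \subset \mathbb{R}^d$ (a nonempty bounded open set with piecewise smooth boundary) that is invisible from a point, i.e. there is a point $O \in \mathbb{R}^d \setminus \bar B$ such that $B$ is invisible from $O$. If $d \ge 3$, then the body $B$ is connected (that is, for $d \ge 3$ there exists a connected body $B \subset \mathbb{R}^d$ invisible from a point).
   Context: A body is a (nonempty) bounded open set $B \subset \mathbb{R}^d$, $d \ge 2$, with piecewise smooth boundary; its surface is regarded as a perfect mirror, and light propagates in $\mathbb{R}^d \setminus B$ according to the billiard law. A regular point of $\partial B$ is a point near which the boundary is smooth, so that the outer normal to $\partial B$ is defined there. Let $O \in \mathbb{R}^d \setminus \bar B$. A billiard trajectory emanating from $O$ is a semi-infinite broken line $l \subset \mathbb{R}^d \setminus B$ with endpoint $O$ such that the endpoints of its segments (except for $O$) are regular points of $\partial B$, and the outer normal to $\partial B$ at any such point is the bisector of the angle formed by the two segments of $l$ adjoining that point. (A ray with vertex $O$ contained in $\mathbb{R}^d \setminus B$ is itself such a trajectory, with no reflections, consisting of a single infinite segment.) The body $B$ is invisible from a point $O \notin \bar B$ if for almost every ray with vertex at $O$ (with respect to the surface measure on the sphere $S^{d-1}$ of directions) there exists a billiard trajectory emanating from $O$ with a finite number of segments such that both the first segment (adjoining $O$) and the last (infinite) segment belong to this ray. *)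

theory Defs
  imports "HOL-Analysis.Analysis"
begin

(* Ck_on k f U: f is of class C^k on the open set U. Quantifying over all directions v keeps every
   iterated derivative real-valued, so that one type suffices for the recursion. *)
primrec Ck_on :: "nat \<Rightarrow> ('a::euclidean_space \<Rightarrow> real) \<Rightarrow> 'a set \<Rightarrow> bool" where
  "Ck_on 0 f U \<longleftrightarrow> continuous_on U f"
| "Ck_on (Suc k) f U \<longleftrightarrow>
     (\<forall>x\<in>U. f differentiable (at x)) \<and>
     (\<forall>v. Ck_on k (\<lambda>x. frechet_derivative f (at x) v) U)"

definition smooth_on :: "('a::euclidean_space \<Rightarrow> real) \<Rightarrow> 'a set \<Rightarrow> bool" where
  "smooth_on f U \<longleftrightarrow> (\<forall>k. Ck_on k f U)"

(* p is a boundary point of B near which B is one side of a smooth hypersurface, namely {f < 0};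
   n is the unit normal pointing out of B. *)
definition outer_normal_at :: "'a::euclidean_space set \<Rightarrow> 'a \<Rightarrow> 'a \<Rightarrow> bool" where
  "outer_normal_at B p n \<longleftrightarrow>
     (\<exists>U f w. open U \<and> p \<in> U \<and> smooth_on f U \<and> f p = 0 \<and> GDERIV f p :> w \<and> w \<noteq> 0 \<and>
        B \<inter> U = {x \<in> U. f x < 0} \<and> n = sgn w)"

definition regular_point :: "'a::euclidean_space set \<Rightarrow> 'a \<Rightarrow> bool" where
  "regular_point B p \<longleftrightarrow> (\<exists>n. outer_normal_at B p n)"

(* Near p, the set S is the part of the smooth hypersurface {h 0 = 0} cut out by k transversal
   inequalities h i \<ge> 0 that are active at p: p is a relative interior point of S for k = 0,
   a smooth boundary point for k = 1, and a corner for k \<ge> 2. *)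
definition hypersurface_corner_at :: "nat \<Rightarrow> 'a::euclidean_space set \<Rightarrow> 'a \<Rightarrow> bool" where
  "hypersurface_corner_at k S p \<longleftrightarrow>
     (\<exists>U h w. open U \<and> p \<in> U \<and>
        (\<forall>i\<le>k. smooth_on (h i) U \<and> h i p = 0 \<and> GDERIV (h i) p :> w i) \<and>
        inj_on w {..k} \<and> independent (w ` {..k}) \<and>
        S \<inter> U = {x \<in> U. h 0 x = 0 \<and> (\<forall>i\<in>{1..k}. 0 \<le> h i x)})"

definition smooth_piece :: "'a::euclidean_space set \<Rightarrow> bool" where
  "smooth_piece S \<longleftrightarrow> compact S \<and> (\<forall>p\<in>S. \<exists>k. hypersurface_corner_at k S p)"

(* The boundary is a finite union of compact smooth hypersurfaces with boundary and corners;
   singular points of the boundary may occur only along the edges of the pieces. *)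
definition piecewise_smooth_boundary :: "'a::euclidean_space set \<Rightarrow> bool" where
  "piecewise_smooth_boundary B \<longleftrightarrow>
     (\<exists>\<S>. finite \<S> \<and> frontier B = \<Union>\<S> \<and>
        (\<forall>S\<in>\<S>. smooth_piece S \<and> (\<forall>p\<in>S. hypersurface_corner_at 0 S p \<longrightarrow> regular_point B p)))"

definition body :: "'a::euclidean_space set \<Rightarrow> bool" where
  "body B \<longleftrightarrow> B \<noteq> {} \<and> bounded B \<and> open B \<and> piecewise_smooth_boundary B"

definition ray :: "'a::real_vector \<Rightarrow> 'a \<Rightarrow> 'a set" where
  "ray a v = {a + t *\<^sub>R v | t. 0 \<le> t}"

definition vec_angle :: "'a::real_inner \<Rightarrow> 'a \<Rightarrow> real" where
  "vec_angle u v = arccos (inner u v / (norm u * norm v))"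

(* The ray spanned by n divides the angle formed by the rays spanned by u and v into two halves.
   A straight angle is included; its bisectors are all the perpendiculars. *)
definition bisects_angle :: "'a::real_inner \<Rightarrow> 'a \<Rightarrow> 'a \<Rightarrow> bool" where
  "bisects_angle n u v \<longleftrightarrow>
     vec_angle u n = vec_angle n v \<and> vec_angle u n + vec_angle n v = vec_angle u v"

(* A semi-infinite broken line with m + 1 segments is given by its vertices x 0, ..., x m together
   with one further point x (m + 1) of its infinite segment. *)
definition line_segment :: "(nat \<Rightarrow> 'a::real_vector) \<Rightarrow> nat \<Rightarrow> nat \<Rightarrow> 'a set" where
  "line_segment x m i =
     (if i < m then closed_segment (x i) (x (Suc i)) else ray (x m) (x (Suc m) - x m))"

definition billiard_trajectory :: "'a::euclidean_space set \<Rightarrow> 'a \<Rightarrow> (nat \<Rightarrow> 'a) \<Rightarrow> nat \<Rightarrow> bool" where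
  "billiard_trajectory B P x m \<longleftrightarrow>
     x 0 = P \<and> (\<forall>i\<le>m. x i \<noteq> x (Suc i)) \<and> (\<forall>i\<le>m. line_segment x m i \<subseteq> - B) \<and>
     (\<forall>i\<in>{1..m}. \<exists>n. outer_normal_at B (x i) n \<and>
        bisects_angle n (x (i - 1) - x i) (x (i + 1) - x i))"

(* Surface measure on the unit sphere: a set A of directions has measure d times the volume of the
   cone {t u | 0 < t < 1, u \<in> A} over it, d being the dimension. *)
definition sphere_measure :: "'a::euclidean_space measure" where
  "sphere_measure = scale_measure (of_nat DIM('a))
     (distr (restrict_space lborel (ball 0 1 - {0})) (restrict_space borel (sphere 0 1)) sgn)"

lemma measurable_sgn_sphere:
  "sgn \<in> restrict_space lborel (ball 0 1 - {0}) \<rightarrow>\<^sub>M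
     restrict_space borel (sphere 0 (1::real) :: 'a::euclidean_space set)"
proof (rule measurable_restrict_space2)
  show "sgn \<in> space (restrict_space lborel (ball 0 1 - {0})) \<rightarrow> (sphere 0 1 :: 'a set)"
    by (auto simp: space_restrict_space norm_sgn)
  have "sgn \<in> borel_measurable (borel :: 'a measure)"
    unfolding sgn_div_norm[abs_def] by measurable
  then show "sgn \<in> borel_measurable (restrict_space lborel (ball 0 1 - {0 :: 'a}))"
    by (intro measurable_restrict_space1) simp
qed

lemma space_sphere_measure: "space (sphere_measure :: 'a::euclidean_space measure) = sphere 0 1"
  by (simp add: sphere_measure_def space_scale_measure space_restrict_space)

lemma sets_sphere_measure:
  "sets (sphere_measure :: 'a::euclidean_space measure) = sets (restrict_space borel (sphere 0 1))"
  by (simp add: sphere_measure_def)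

lemma emeasure_sphere_measure:
  fixes A :: "'a::euclidean_space set"
  assumes "A \<in> sets borel" "A \<subseteq> sphere 0 1"
  shows "emeasure sphere_measure A =
    of_nat DIM('a) * emeasure lborel {t *\<^sub>R u | t u. 0 < t \<and> t < 1 \<and> u \<in> A}"
proof -
  have A: "A \<in> sets (restrict_space borel (sphere 0 1))"
    using assms by (auto simp: sets_restrict_space)
  have B: "ball 0 1 - {0} \<in> sets (lborel :: 'a measure)" by simp
  have cone: "sgn -` A \<inter> (ball 0 1 - {0}) = {t *\<^sub>R u | t u. 0 < t \<and> t < 1 \<and> u \<in> A}"
    (is "?L = ?R")
  proof
    show "?L \<subseteq> ?R"
    proof
      fix x assume x: "x \<in> ?L"
      then have "x = norm x *\<^sub>R sgn x" by (simp add: sgn_div_norm)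
      then show "x \<in> ?R" using x by (auto intro!: exI[of _ "norm x"] exI[of _ "sgn x"])
    qed
    show "?R \<subseteq> ?L"
      using assms(2) by (auto simp: sgn_div_norm subset_iff)
  qed
  have sub: "{t *\<^sub>R u | t u. 0 < t \<and> t < 1 \<and> u \<in> A} \<subseteq> ball 0 1 - {0}"
    unfolding cone[symmetric] by blast
  have "emeasure sphere_measure A =
      of_nat DIM('a) * emeasure (restrict_space lborel (ball 0 1 - {0})) (sgn -` A \<inter> (ball 0 1 - {0}))"
    using A by (simp add: sphere_measure_def emeasure_distr[OF measurable_sgn_sphere] space_restrict_space)
  also have "emeasure (restrict_space lborel (ball 0 1 - {0})) (sgn -` A \<inter> (ball 0 1 - {0})) =
      emeasure lborel {t *\<^sub>R u | t u. 0 < t \<and> t < 1 \<and> u \<in> A}"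
    unfolding cone using sub by (intro emeasure_restrict_space) auto
  finally show ?thesis .
qed

definition invisible_from :: "'a::euclidean_space set \<Rightarrow> 'a \<Rightarrow> bool" where
  "invisible_from B P \<longleftrightarrow> P \<notin> closure B \<and>
     (AE u in sphere_measure. \<exists>x m. billiard_trajectory B P x m \<and>
        line_segment x m 0 \<subseteq> ray P u \<and> line_segment x m m \<subseteq> ray P u)"

end

(* Let an ellipse of eccentricity 1/2 and a hyperbola of eccentricity 2 have the common foci O and F.
   If a ray from O meets the ellipse at P and, further on, the hyperbola at Q, then F lies on the
   segment from P to the mirror image Q' of Q in the axis OF. Hence light that leaves O in the
   direction of P is reflected at P to F and at Q' into a ray that seems to leave O in the mirror
   image of its original direction. A second pair of mirrors, the first one enlarged from O,
   restores the original direction. The body fills the space between the two mirrors of either pair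
   in a thin cone around the axis, rotated about the axis.

   For connectedness, the meridian half-planes are divided into two classes, each symmetric under
   reflection in the axis, and the mirrors over the second class are enlarged by the factor 2.
   Light never leaves the plane spanned by its direction and the axis, so the classes do not
   interfere; but along their interface the pieces of one class overlap those of the other in a
   chain, and for d >= 3 every piece is adjacent to the interface. *)
theory Submission
  imports Defs
begin

section \<open>Smooth functions\<close>

text \<open>The mirrors of size s have the polar equations \<open>ell x = s\<close> and
  \<open>hyp x = s\<close>, and the norm cancels in the sum:
  \<open>ell x + hyp x = 3 / 2 * (x \<bullet> e)\<close>. This identity is why the reciprocal
  eccentricities put F on the segment from P to Q'. Conversely, \<open>norm x\<close> and
  \<open>x \<bullet> e\<close> are linear in \<open>ell x\<close> and \<open>hyp x\<close>, so off
  the axis these two functions serve as coordinates in a meridian half-plane. There every face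
  except the interface is a straight edge and the piece of size t is the quadrilateral
  \<open>quad t\<close>; transversality of the faces and membership in the frontier become linear
  algebra and linear arithmetic. The cone 4 < ell / hyp < 5 governs the other constants. The piece
  of size t has \<open>ell\<close> between t and 5 t and \<open>hyp\<close> between t / 5 and t. The
  factor 6 exceeds 5, which separates the two pairs of one class and lets the light inside either
  pair pass clear of the other. The sizes 1, 2, 6, 12, taken alternately from both classes, have
  successive ratios at most 3, less than 5, so neighbouring quadrilaterals overlap.\<close>

lemma has_derivative_imp_frechet:
  assumes "(f has_derivative F) (at x)"
  shows "frechet_derivative f (at x) = F"
  using assms frechet_derivative_at by metis

lemma Ck_on_cong:
  assumes "open U" "\<And>x. x \<in> U \<Longrightarrow> f x = g x" "Ck_on k f U"
  shows "Ck_on k g U"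
  using assms(2,3)
proof (induction k arbitrary: f g)
  case 0
  then show ?case using continuous_on_cong[of U U f g] by simp
next
  case (Suc k)
  have D: "(g has_derivative frechet_derivative f (at x)) (at x)" if "x \<in> U" for x
  proof (rule has_derivative_transform_within_open)
    show "(f has_derivative frechet_derivative f (at x)) (at x)"
      using Suc.prems(2) that by (simp add: frechet_derivative_works)
  qed (use assms(1) that Suc.prems in auto)
  show ?case
    unfolding Ck_on.simps
  proof (intro conjI ballI allI)
    show "g differentiable at x" if "x \<in> U" for x
      using D[OF that] by (auto simp: differentiable_def)
    show "Ck_on k (\<lambda>x. frechet_derivative g (at x) v) U" for v
    proof (rule Suc.IH)
      show "Ck_on k (\<lambda>x. frechet_derivative f (at x) v) U" using Suc.prems(2) by simp
      show "frechet_derivative f (at x) v = frechet_derivative g (at x) v" if "x \<in> U" for x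
        using has_derivative_imp_frechet[OF D[OF that]] by simp
    qed
  qed
qed

text \<open>Derivatives are unique, so an explicit derivative \<open>F\<close> may replace
  \<open>frechet_derivative\<close>; \<open>Ck_on_cong\<close> carries this through the
  recursion.\<close>

lemma Ck_on_SucI:
  assumes "open U" "\<And>x. x \<in> U \<Longrightarrow> (f has_derivative F x) (at x)" "\<And>v. Ck_on k (\<lambda>x. F x v) U"
  shows "Ck_on (Suc k) f U"
  unfolding Ck_on.simps
proof (intro conjI ballI allI)
  show "f differentiable at x" if "x \<in> U" for x
    using assms(2)[OF that] by (auto simp: differentiable_def)
  show "Ck_on k (\<lambda>x. frechet_derivative f (at x) v) U" for v
  proof (rule Ck_on_cong[OF assms(1) _ assms(3)[of v]])
    show "F x v = frechet_derivative f (at x) v" if "x \<in> U" for x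
      using has_derivative_imp_frechet[OF assms(2)[OF that]] by simp
  qed
qed

lemma Ck_on_Suc_D:
  assumes "Ck_on (Suc k) f U" "x \<in> U"
  shows "(f has_derivative frechet_derivative f (at x)) (at x)"
  using assms by (simp add: frechet_derivative_works)

lemma Ck_on_SucD: "Ck_on (Suc k) f U \<Longrightarrow> Ck_on k f U"
proof (induction k arbitrary: f)
  case 0
  then have "\<forall>x\<in>U. f differentiable at x" by simp
  then have "f differentiable_on U"
    unfolding differentiable_on_def by (blast intro: differentiable_at_withinI)
  then show ?case by (simp add: differentiable_imp_continuous_on)
next
  case (Suc k)
  show ?case
    unfolding Ck_on.simps(2)[of k f U]
  proof (intro conjI allI)
    show "\<forall>x\<in>U. f differentiable at x" using Suc.prems unfolding Ck_on.simps(2)[of "Suc k"] by blast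
    show "Ck_on k (\<lambda>x. frechet_derivative f (at x) v) U" for v
      by (rule Suc.IH) (use Suc.prems in \<open>unfold Ck_on.simps(2)[of "Suc k"], blast\<close>)
  qed
qed

lemma Ck_on_const: "open U \<Longrightarrow> Ck_on k (\<lambda>x. c) U"
proof (induction k arbitrary: c)
  case (Suc k)
  then show ?case by (intro Ck_on_SucI[where F = "\<lambda>x v. 0"]) auto
qed simp

lemma Ck_on_add:
  assumes "open U"
  shows "Ck_on k f U \<Longrightarrow> Ck_on k g U \<Longrightarrow> Ck_on k (\<lambda>x. f x + g x) U"
proof (induction k arbitrary: f g)
  case 0
  then show ?case by (simp add: continuous_on_add)
next
  case (Suc k)
  show ?case
    by (rule Ck_on_SucI[OF assms(1) has_derivative_add[OF Ck_on_Suc_D[OF Suc.prems(1)]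
            Ck_on_Suc_D[OF Suc.prems(2)]]]) (use Suc in auto)
qed

lemma Ck_on_mult:
  assumes "open U"
  shows "Ck_on k f U \<Longrightarrow> Ck_on k g U \<Longrightarrow> Ck_on k (\<lambda>x. f x * g x) U"
proof (induction k arbitrary: f g)
  case 0
  then show ?case by (simp add: continuous_on_mult)
next
  case (Suc k)
  show ?case
  proof (rule Ck_on_SucI[OF assms(1) has_derivative_mult[OF Ck_on_Suc_D[OF Suc.prems(1)]
            Ck_on_Suc_D[OF Suc.prems(2)]]])
    show "Ck_on k (\<lambda>x. f x * frechet_derivative g (at x) v +
        frechet_derivative f (at x) v * g x) U" for v
      by (intro Ck_on_add[OF assms(1)] Suc.IH) (use Suc.prems Ck_on_SucD in auto)
  qed
qed

lemma Ck_on_inner: "open U \<Longrightarrow> Ck_on k (\<lambda>x. x \<bullet> a) U"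
proof (cases k)
  case 0
  then show ?thesis by (auto intro!: continuous_intros)
next
  case (Suc n)
  assume "open U"
  then show ?thesis unfolding Suc
    by (intro Ck_on_SucI[where F = "\<lambda>x v. v \<bullet> a"] Ck_on_const)
       (auto intro!: derivative_eq_intros)
qed

lemma has_derivative_norm_nonzero:
  fixes x :: "'a::real_inner"
  assumes "x \<noteq> 0"
  shows "(norm has_derivative (\<lambda>v. (x \<bullet> v) * inverse (norm x))) (at x)"
proof -
  have "(\<lambda>v. (x \<bullet> v) * inverse (norm x)) = (\<lambda>h. h \<bullet> sgn x)"
    by (auto simp: sgn_div_norm inner_commute mult.commute)
  then show ?thesis using has_derivative_norm[OF assms] by simp
qed

text \<open>The directional derivative of 1 / norm is a product of a linear form and powers of 1 /
  norm itself, so the induction closes. The norm is reached from here, its derivative being a linear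
  form times 1 / norm.\<close>

lemma Ck_on_inverse_norm: "Ck_on k (\<lambda>x::'a::euclidean_space. inverse (norm x)) (- {0})"
proof (induction k)
  case 0
  show ?case by (auto intro!: continuous_intros)
next
  case (Suc k)
  have o: "open (- {0::'a})" by auto
  let ?i = "\<lambda>x::'a. inverse (norm x)"
  show ?case
  proof (rule Ck_on_SucI[OF o, where F = "\<lambda>x v. (-1) * (((x \<bullet> v) * ?i x) * (?i x * ?i x))"])
    show "(?i has_derivative (\<lambda>v. (-1) * (((x \<bullet> v) * ?i x) * (?i x * ?i x)))) (at x)"
      if "x \<in> - {0}" for x
      using that by (auto intro!: derivative_eq_intros has_derivative_norm_nonzero simp: field_simps)
    show "Ck_on k (\<lambda>x. (-1) * (((x \<bullet> v) * ?i x) * (?i x * ?i x))) (- {0})" for v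
      by (intro Ck_on_mult[OF o] Ck_on_const[OF o] Ck_on_inner[OF o] Suc)
  qed
qed

lemma smooth_on_const: "open U \<Longrightarrow> smooth_on (\<lambda>x. c) U"
  by (simp add: smooth_on_def Ck_on_const)

lemma smooth_on_inner: "open U \<Longrightarrow> smooth_on (\<lambda>x. x \<bullet> a) U"
  by (simp add: smooth_on_def Ck_on_inner)

lemma smooth_on_add:
  "open U \<Longrightarrow> smooth_on f U \<Longrightarrow> smooth_on g U \<Longrightarrow> smooth_on (\<lambda>x. f x + g x) U"
  by (simp add: smooth_on_def Ck_on_add)

lemma smooth_on_mult:
  "open U \<Longrightarrow> smooth_on f U \<Longrightarrow> smooth_on g U \<Longrightarrow> smooth_on (\<lambda>x. f x * g x) U"
  by (simp add: smooth_on_def Ck_on_mult)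

lemma smooth_on_norm: "smooth_on norm (- {0::'a::euclidean_space})"
  unfolding smooth_on_def
proof
  fix k
  have o: "open (- {0::'a})" by auto
  have "Ck_on (Suc k) norm (- {0::'a})"
  proof (rule Ck_on_SucI[OF o, where F = "\<lambda>x v. (x \<bullet> v) * inverse (norm x)"])
    show "(norm has_derivative (\<lambda>v. (x \<bullet> v) * inverse (norm x))) (at x)"
      if "x \<in> - {0}" for x :: 'a
      using that by (auto intro: has_derivative_norm_nonzero)
    show "Ck_on k (\<lambda>x::'a. (x \<bullet> v) * inverse (norm x)) (- {0})" for v
      by (intro Ck_on_mult[OF o] Ck_on_inner[OF o] Ck_on_inverse_norm)
  qed
  then show "Ck_on k norm (- {0::'a})" by (rule Ck_on_SucD)
qed

lemma Ck_on_subset: "Ck_on k f U \<Longrightarrow> V \<subseteq> U \<Longrightarrow> Ck_on k f V"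
  by (induction k arbitrary: f) (auto intro: continuous_on_subset)

lemma smooth_on_subset: "smooth_on f U \<Longrightarrow> V \<subseteq> U \<Longrightarrow> smooth_on f V"
  by (auto simp: smooth_on_def intro: Ck_on_subset)

lemma smooth_on_imp_continuous_on: "smooth_on f U \<Longrightarrow> continuous_on U f"
  unfolding smooth_on_def by (metis Ck_on.simps(1))

section \<open>Pieces of hypersurfaces and reflections\<close>

lemma GDERIV_error_bound:
  assumes "GDERIV f p :> a" "\<eta> > 0"
  obtains d where "d > 0" "\<And>y. norm y < d \<Longrightarrow> \<bar>f (p + y) - f p - y \<bullet> a\<bar> \<le> \<eta> * norm y"
proof -
  have "(f has_derivative (\<lambda>h. h \<bullet> a)) (at p)" using assms(1) by (simp add: gderiv_def)
  then obtain d where d: "d > 0"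
    "\<And>y. norm (y - p) < d \<Longrightarrow> norm (f y - f p - (y - p) \<bullet> a) \<le> \<eta> * norm (y - p)"
    using assms(2) unfolding has_derivative_at_alt by blast
  show thesis
    by (rule that[OF d(1)]) (use d(2)[of "p + _"] in simp)
qed

text \<open>A tangent direction \<open>v\<close> of \<open>{h = 0}\<close> is realised by zeros \<open>p + t (v + \<theta> w)\<close> of \<open>h\<close>
  with small \<open>t\<close> and \<open>\<theta>\<close>, which the intermediate value theorem provides.\<close>

lemma tangent_inner_nonneg:
  fixes h g :: "'a::euclidean_space \<Rightarrow> real"
  assumes U: "open U" "p \<in> U" and h: "continuous_on U h" "h p = 0" "GDERIV h p :> w" "w \<noteq> 0"
    and g: "g p = 0" "GDERIV g p :> b" "\<And>x. x \<in> U \<Longrightarrow> h x = 0 \<Longrightarrow> 0 \<le> g x"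
    and v: "v \<bullet> w = 0"
  shows "0 \<le> v \<bullet> b"
proof (rule ccontr)
  assume "\<not> 0 \<le> v \<bullet> b"
  then have neg: "v \<bullet> b < 0" by simp
  \<comment> \<open>For \<theta> of absolute value at most \<delta>, the term \<theta> (w \<bullet>
    b) makes up for at most half of the deficit of v \<bullet> b. The bound \<eta> below keeps the
    remainders under the other half, and also under \<delta> (w \<bullet> w), which fixes the signs
    of \<open>h\<close> at the two ends.\<close>
  define \<delta> where "\<delta> = - (v \<bullet> b) / (2 * (\<bar>w \<bullet> b\<bar> + 1))"
  have \<delta>: "\<delta> > 0" using neg by (simp add: \<delta>_def divide_neg_pos)
  have \<delta>w: "\<delta> * \<bar>w \<bullet> b\<bar> \<le> - (v \<bullet> b) / 2"
  proof -
    have "\<delta> * \<bar>w \<bullet> b\<bar> \<le> \<delta> * (\<bar>w \<bullet> b\<bar> + 1)" using \<delta> by simp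
    also have "\<dots> = - (v \<bullet> b) / 2"
    proof -
      have "c / (2 * q) * q = c / 2" if "q > 0" for c q :: real using that by simp
      then show ?thesis unfolding \<delta>_def by (metis abs_ge_zero add_nonneg_pos zero_less_one)
    qed
    finally show ?thesis .
  qed
  define M where "M = norm v + \<delta> * norm w"
  have M: "M > 0" using \<delta> h(4) by (simp add: M_def add_nonneg_pos)
  define \<eta> where "\<eta> = min (- (v \<bullet> b) / 4) (\<delta> * (w \<bullet> w) / 2) / M"
  have ww: "w \<bullet> w > 0" using h(4) by simp
  have \<eta>: "\<eta> > 0" using neg \<delta> M ww by (simp add: \<eta>_def)
  have \<eta>1: "\<eta> * M < - (v \<bullet> b) / 2" and \<eta>2: "\<eta> * M < \<delta> * (w \<bullet> w)"
    using neg \<delta> M ww by (auto simp: \<eta>_def min_def not_le)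
  obtain d1 where d1: "d1 > 0" "\<And>y. norm y < d1 \<Longrightarrow> \<bar>h (p + y) - h p - y \<bullet> w\<bar> \<le> \<eta> * norm y"
    using GDERIV_error_bound[OF h(3) \<eta>] by blast
  obtain d2 where d2: "d2 > 0" "\<And>y. norm y < d2 \<Longrightarrow> \<bar>g (p + y) - g p - y \<bullet> b\<bar> \<le> \<eta> * norm y"
    using GDERIV_error_bound[OF g(2) \<eta>] by blast
  obtain d3 where d3: "d3 > 0" "ball p d3 \<subseteq> U" using U by (meson open_contains_ball)
  define t where "t = min d1 (min d2 d3) / (2 * M)"
  have t: "t > 0" using d1 d2 d3 M by (simp add: t_def)
  have tM: "t * M < d1" "t * M < d2" "t * M < d3"
    using d1(1) d2(1) d3(1) M by (auto simp: t_def min_def)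
  define y where "y = (\<lambda>\<theta>::real. t *\<^sub>R (v + \<theta> *\<^sub>R w))"
  have ny: "norm (y \<theta>) \<le> t * M" if "\<bar>\<theta>\<bar> \<le> \<delta>" for \<theta>
  proof -
    have "norm (v + \<theta> *\<^sub>R w) \<le> norm v + \<bar>\<theta>\<bar> * norm w"
      using norm_triangle_ineq[of v "\<theta> *\<^sub>R w"] by simp
    also have "\<dots> \<le> M" using that by (simp add: M_def mult_right_mono)
    finally show ?thesis using t by (simp add: y_def)
  qed
  have inU: "p + y \<theta> \<in> U" if "\<bar>\<theta>\<bar> \<le> \<delta>" for \<theta>
    using ny[OF that] tM(3) d3(2) by (auto simp: subset_iff dist_norm)
  have err: "\<eta> * norm (y \<theta>) \<le> t * (\<eta> * M)" if "\<bar>\<theta>\<bar> \<le> \<delta>" for \<theta>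
    using mult_left_mono[OF ny[OF that], of \<eta>] \<eta> by (simp add: algebra_simps)
  have yw: "y \<theta> \<bullet> w = t * (\<theta> * (w \<bullet> w))" for \<theta>
    using v by (simp add: y_def inner_add_left)
  have abs\<delta>: "\<bar>\<delta>\<bar> \<le> \<delta>" "\<bar>- \<delta>\<bar> \<le> \<delta>" using \<delta> by auto
  have te: "t * (\<eta> * M) < t * (\<delta> * (w \<bullet> w))" using \<eta>2 t by simp
  have up: "0 \<le> h (p + y \<delta>)"
    using d1(2)[of "y \<delta>"] ny[OF abs\<delta>(1)] tM(1) err[OF abs\<delta>(1)] te h(2) yw[of \<delta>] by simp
  have lo: "h (p + y (- \<delta>)) \<le> 0"
    using d1(2)[of "y (- \<delta>)"] ny[OF abs\<delta>(2)] tM(1) err[OF abs\<delta>(2)] te h(2) yw[of "- \<delta>"] by simp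
  have "continuous_on {-\<delta>..\<delta>} (\<lambda>\<theta>. h (p + y \<theta>))"
    by (rule continuous_on_compose2[OF h(1)]) (auto simp: y_def intro!: continuous_intros inU[unfolded y_def])
  then obtain \<theta> where \<theta>: "-\<delta> \<le> \<theta>" "\<theta> \<le> \<delta>" "h (p + y \<theta>) = 0"
    using IVT'[of "\<lambda>\<theta>. h (p + y \<theta>)" "-\<delta>" 0 \<delta>] lo up \<delta> by auto
  then have a\<theta>: "\<bar>\<theta>\<bar> \<le> \<delta>" by auto
  have "0 \<le> g (p + y \<theta>)" by (rule g(3)[OF inU[OF a\<theta>] \<theta>(3)])
  also have "\<dots> \<le> y \<theta> \<bullet> b + t * (\<eta> * M)"
    using d2(2)[of "y \<theta>"] ny[OF a\<theta>] tM(2) err[OF a\<theta>] g(1) by simp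
  also have "y \<theta> \<bullet> b = t * (v \<bullet> b + \<theta> * (w \<bullet> b))" by (simp add: y_def inner_add_left)
  finally have "0 \<le> t * (v \<bullet> b + \<theta> * (w \<bullet> b) + \<eta> * M)" by (simp add: algebra_simps)
  then have "0 \<le> v \<bullet> b + \<theta> * (w \<bullet> b) + \<eta> * M" using t by (simp add: zero_le_mult_iff)
  moreover have "\<theta> * (w \<bullet> b) \<le> \<delta> * \<bar>w \<bullet> b\<bar>"
    using mult_right_mono[OF a\<theta>, of "\<bar>w \<bullet> b\<bar>"] abs_ge_self[of "\<theta> * (w \<bullet> b)"] by (simp add: abs_mult)
  ultimately show False using \<delta>w \<eta>1 by simp
qed

text \<open>At a relative interior point the tangent space is all of the orthogonal complement of
  \<open>w 0\<close>. Both \<open>f\<close> and \<open>g\<close> are nonnegative on S and zero at p,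
  so their derivatives are nonnegative along every tangent v and along -v, hence zero. Both
  gradients are then multiples of \<open>w 0\<close>.\<close>

lemma not_relative_interior_at_edge:
  assumes S: "hypersurface_corner_at 0 S p"
    and fg: "\<And>x. x \<in> S \<Longrightarrow> f x = 0" "\<And>x. x \<in> S \<Longrightarrow> 0 \<le> g x" "p \<in> S" "g p = 0"
    and grad: "GDERIV f p :> a" "GDERIV g p :> b"
  obtains \<alpha> \<beta> where "\<alpha> *\<^sub>R a + \<beta> *\<^sub>R b = 0" "\<alpha> \<noteq> 0 \<or> \<beta> \<noteq> 0"
proof -
  obtain U h w where U: "open U" "p \<in> U" and h: "smooth_on (h 0) U" "h 0 p = 0" "GDERIV (h 0) p :> w 0"
    and ind: "independent (w ` {..0::nat})" and SU: "S \<inter> U = {x \<in> U. h 0 x = 0}"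
    using S unfolding hypersurface_corner_at_def by auto
  have w0: "w 0 \<noteq> 0" using ind dependent_zero[of "w ` {..0}"] by force
  have fg': "f x = 0 \<and> 0 \<le> g x" if "x \<in> U" "h 0 x = 0" for x
    using SU fg(1,2) that by blast
  have fp: "f p = 0" using fg by blast
  have nonneg: "0 \<le> v \<bullet> b" "0 \<le> v \<bullet> a" if "v \<bullet> w 0 = 0" for v
    using tangent_inner_nonneg[OF U smooth_on_imp_continuous_on[OF h(1)] h(2,3) w0 fg(4) grad(2) _ that]
      tangent_inner_nonneg[OF U smooth_on_imp_continuous_on[OF h(1)] h(2,3) w0 fp grad(1) _ that] fg'
    by auto
  have par: "y = ((y \<bullet> w 0) / (w 0 \<bullet> w 0)) *\<^sub>R w 0" if "\<And>v. v \<bullet> w 0 = 0 \<Longrightarrow> 0 \<le> v \<bullet> y" for y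
  proof -
    define v where "v = y - ((y \<bullet> w 0) / (w 0 \<bullet> w 0)) *\<^sub>R w 0"
    have v: "v \<bullet> w 0 = 0" using w0 by (simp add: v_def inner_diff_left)
    have "v \<bullet> y = 0" using that[OF v] that[of "- v"] v by simp
    then have "v \<bullet> v = 0" using v by (simp add: v_def inner_diff_right)
    then show ?thesis by (simp add: v_def)
  qed
  define ra where "ra = (a \<bullet> w 0) / (w 0 \<bullet> w 0)"
  define rb where "rb = (b \<bullet> w 0) / (w 0 \<bullet> w 0)"
  have a: "a = ra *\<^sub>R w 0" and b: "b = rb *\<^sub>R w 0"
    unfolding ra_def rb_def using par nonneg by blast+
  show thesis
  proof (cases "ra = 0")
    case True
    then show ?thesis using that[of 1 0] a by simp
  next
    case False
    then show ?thesis using that[of rb "- ra"] a b by simp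
  qed
qed

text \<open>Passes from independence of an indexed family, which is what computations with
  coefficients give, to the two conditions on a set of vectors in
  \<open>hypersurface_corner_at\<close>.\<close>

lemma independent_family_imp_inj_independent:
  assumes J: "finite J"
    and ind: "\<And>c. (\<Sum>i\<in>J. c i *\<^sub>R w i) = 0 \<Longrightarrow> \<forall>i\<in>J. c i = (0::real)"
  shows "inj_on w J" "independent (w ` J)"
proof -
  show inj: "inj_on w J"
  proof (rule inj_onI, rule ccontr)
    fix i j assume ij: "i \<in> J" "j \<in> J" "w i = w j" "i \<noteq> j"
    let ?c = "\<lambda>k. if k = i then 1 else if k = j then -1 else (0::real)"
    have "(\<Sum>k\<in>J. ?c k *\<^sub>R w k) = (\<Sum>k\<in>{i,j}. ?c k *\<^sub>R w k)"
      by (rule sum.mono_neutral_right[OF J]) (use ij in auto)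
    also have "\<dots> = 0" using ij by simp
    finally have "\<forall>k\<in>J. ?c k = 0" by (rule ind)
    from bspec[OF this ij(1)] show False by simp
  qed
  show "independent (w ` J)"
    unfolding dependent_finite[OF finite_imageI[OF J]]
  proof (rule notI, elim exE conjE bexE)
    fix u x assume u: "x \<in> w ` J" "u x \<noteq> 0" "(\<Sum>v\<in>w ` J. u v *\<^sub>R v) = 0"
    have "(\<Sum>i\<in>J. u (w i) *\<^sub>R w i) = 0" using u(3) by (simp add: sum.reindex[OF inj])
    then have "\<forall>i\<in>J. u (w i) = 0" by (rule ind)
    with u(1,2) show False by auto
  qed
qed

text \<open>The inequalities describe S globally, but only those with equality at p matter near p.
  Accordingly \<open>ind\<close> asks for independence of the active gradients alone, by considering
  coefficients that vanish on all inactive indices.\<close>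

locale smooth_polytope_piece =
  fixes h :: "nat \<Rightarrow> 'a::euclidean_space \<Rightarrow> real" and n :: nat and W S :: "'a set"
    and w :: "nat \<Rightarrow> 'a \<Rightarrow> 'a"
  assumes W: "open W"
    and smooth: "i \<le> n \<Longrightarrow> smooth_on (h i) W"
    and grad: "i \<le> n \<Longrightarrow> x \<in> W \<Longrightarrow> GDERIV (h i) x :> w i x"
    and S: "S = {x \<in> W. h 0 x = 0 \<and> (\<forall>i\<in>{1..n}. 0 \<le> h i x)}"
    and compact: "compact S"
    and ind: "p \<in> S \<Longrightarrow> (\<And>i. i \<le> n \<Longrightarrow> h i p \<noteq> 0 \<Longrightarrow> c i = 0) \<Longrightarrow>
      (\<Sum>i\<le>n. c i *\<^sub>R w i p) = 0 \<Longrightarrow> i \<le> n \<Longrightarrow> c i = 0"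
begin

lemma smooth_piece: "smooth_piece S"
  unfolding smooth_piece_def
proof (intro conjI ballI compact)
  fix p assume p: "p \<in> S"
  then have pW: "p \<in> W" and h0: "h 0 p = 0" and nn: "\<And>i. i \<in> {1..n} \<Longrightarrow> 0 \<le> h i p"
    using S by auto
  define J where "J = {i \<in> {1..n}. h i p = 0}"
  have J: "finite J" "0 \<notin> J" "J \<subseteq> {1..n}" by (auto simp: J_def)
  obtain e where e: "bij_betw e {1..card J} J"
    using ex_bij_betw_nat_finite_1[OF J(1)] by blast
  define e' where "e' = e(0 := 0)"
  have eJ: "e' i \<in> J" if "i \<in> {1..card J}" for i
    using bij_betw_apply[OF e that] that by (auto simp: e'_def)
  have img: "e' ` {1..card J} = J"
    using bij_betw_imp_surj_on[OF e] by (auto simp: e'_def)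
  have inj: "inj_on e' {..card J}"
  proof -
    have "inj_on e' {1..card J}"
      using bij_betw_imp_inj_on[OF e] inj_on_cong[of "{1..card J}" e' e] by (simp add: e'_def)
    moreover have "{..card J} = insert 0 {1..card J}" by auto
    moreover have "e' 0 \<notin> e' ` {1..card J}" using img J(2) by (simp add: e'_def)
    ultimately show ?thesis by (simp add: inj_on_insert)
  qed
  have img0: "e' ` {..card J} = insert 0 J"
  proof -
    have "{..card J} = insert 0 {1..card J}" by auto
    moreover have "e' 0 = 0" by (simp add: e'_def)
    ultimately show ?thesis using img by (simp only: image_insert)
  qed
  have indJ: "inj_on (\<lambda>i. w i p) (insert 0 J)" "independent ((\<lambda>i. w i p) ` insert 0 J)"
  proof -
    have *: "\<forall>i\<in>insert 0 J. c i = 0" if "(\<Sum>i\<in>insert 0 J. c i *\<^sub>R w i p) = 0" for c :: "nat \<Rightarrow> real"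
    proof -
      let ?c = "\<lambda>i. if i \<in> insert 0 J then c i else 0"
      have "(\<Sum>i\<le>n. ?c i *\<^sub>R w i p) = (\<Sum>i\<in>insert 0 J. ?c i *\<^sub>R w i p)"
        by (rule sum.mono_neutral_right) (use J in auto)
      also have "\<dots> = (\<Sum>i\<in>insert 0 J. c i *\<^sub>R w i p)" by (rule sum.cong) auto
      also have "\<dots> = 0" by (rule that)
      finally have sum0: "(\<Sum>i\<le>n. ?c i *\<^sub>R w i p) = 0" .
      have "?c i = 0" if "i \<le> n" "h i p \<noteq> 0" for i
        using that h0 by (cases "i = 0") (auto simp: J_def)
      then have c0: "?c i = 0" if "i \<le> n" for i
        using ind[OF p, of ?c, OF _ sum0 that] by blast
      show ?thesis
      proof
        fix i assume i: "i \<in> insert 0 J"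
        then have "i \<le> n" using J(3) by auto
        from c0[OF this] show "c i = 0" using i by simp
      qed
    qed
    show "inj_on (\<lambda>i. w i p) (insert 0 J)" "independent ((\<lambda>i. w i p) ` insert 0 J)"
      using independent_family_imp_inj_independent[of "insert 0 J" "\<lambda>i. w i p"] J(1) * by auto
  qed
  define U where "U = W \<inter> (\<Inter>i\<in>{1..n} - J. {x \<in> W. 0 < h i x})"
  have oU: "open U"
    unfolding U_def
  proof (intro open_Int W open_INT ballI)
    fix i assume "i \<in> {1..n} - J"
    then have "continuous_on W (h i)" by (intro smooth_on_imp_continuous_on smooth) auto
    then have "open (W \<inter> h i -` {0<..})" using W by (intro continuous_open_preimage) auto
    then show "open {x \<in> W. 0 < h i x}" by (simp add: vimage_def Int_def)
  qed auto
  have pU: "p \<in> U" using pW nn by (force simp: U_def J_def)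
  have "hypersurface_corner_at (card J) S p"
    unfolding hypersurface_corner_at_def
  proof (rule exI[of _ U], rule exI[of _ "\<lambda>i. h (e' i)"], rule exI[of _ "\<lambda>i. w (e' i) p"],
      intro conjI)
    show "open U" "p \<in> U" by fact+
    show "\<forall>i\<le>card J. smooth_on (h (e' i)) U \<and> h (e' i) p = 0 \<and> GDERIV (h (e' i)) p :> w (e' i) p"
    proof (intro allI impI conjI)
      fix i assume i: "i \<le> card J"
      then have e'i: "e' i \<in> insert 0 J" using img0 by blast
      then have le: "e' i \<le> n" using J(3) by auto
      show "smooth_on (h (e' i)) U"
        by (rule smooth_on_subset[OF smooth[OF le]]) (auto simp: U_def)
      show "h (e' i) p = 0" using e'i h0 by (auto simp: J_def)
      show "GDERIV (h (e' i)) p :> w (e' i) p" by (rule grad[OF le pW])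
    qed
    show "inj_on (\<lambda>i. w (e' i) p) {..card J}"
    proof -
      have "inj_on (\<lambda>i. w i p) (e' ` {..card J})" using indJ(1) by (simp only: img0)
      from comp_inj_on[OF inj this] show ?thesis by (simp add: comp_def)
    qed
    show "independent ((\<lambda>i. w (e' i) p) ` {..card J})"
    proof -
      have *: "(\<lambda>i. w (e' i) p) ` {..card J} = (\<lambda>i. w i p) ` insert 0 J"
        using arg_cong[OF img0, of "image (\<lambda>i. w i p)"] by (simp only: image_image)
      show ?thesis unfolding * by (rule indJ(2))
    qed
    have *: "(\<forall>i\<in>{1..card J}. 0 \<le> h (e' i) x) \<longleftrightarrow> (\<forall>j\<in>J. 0 \<le> h j x)" for x
    proof -
      have "(\<forall>j\<in>e' ` {1..card J}. 0 \<le> h j x) \<longleftrightarrow> (\<forall>i\<in>{1..card J}. 0 \<le> h (e' i) x)" by blast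
      then show ?thesis by (simp only: img)
    qed
    show "S \<inter> U = {x \<in> U. h (e' 0) x = 0 \<and> (\<forall>i\<in>{1..card J}. 0 \<le> h (e' i) x)}"
      unfolding *
    proof (intro set_eqI iffI)
      fix x assume "x \<in> S \<inter> U"
      then show "x \<in> {x \<in> U. h (e' 0) x = 0 \<and> (\<forall>j\<in>J. 0 \<le> h j x)}"
        using S J(3) by (auto simp: e'_def)
    next
      fix x assume x: "x \<in> {x \<in> U. h (e' 0) x = 0 \<and> (\<forall>j\<in>J. 0 \<le> h j x)}"
      have "0 \<le> h i x" if "i \<in> {1..n}" for i
        using x that by (cases "i \<in> J") (auto simp: U_def intro: less_imp_le)
      then show "x \<in> S \<inter> U" using x S by (auto simp: e'_def U_def)
    qed
  qed
  then show "\<exists>k. hypersurface_corner_at k S p" ..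
qed

text \<open>Regularity of the body is demanded wherever S looks like a hypersurface without edge. An
  active inequality at such a point would make its gradient dependent on that of \<open>h 0\<close>,
  against \<open>ind\<close>; so only points with all inequalities strict need to be
  examined.\<close>

lemma relative_interior_pos:
  assumes p: "p \<in> S" "hypersurface_corner_at 0 S p" and i: "i \<in> {1..n}"
  shows "0 < h i p"
proof (rule ccontr)
  assume "\<not> 0 < h i p"
  then have hi: "h i p = 0" using p(1) i S by force
  have pW: "p \<in> W" using p(1) S by blast
  have h0S: "h 0 x = 0" "0 \<le> h i x" if "x \<in> S" for x using that S i by auto
  have g: "GDERIV (h 0) p :> w 0 p" "GDERIV (h i) p :> w i p"
    using grad[OF _ pW] i by auto
  obtain \<alpha> \<beta> where ab: "\<alpha> *\<^sub>R w 0 p + \<beta> *\<^sub>R w i p = 0" "\<alpha> \<noteq> 0 \<or> \<beta> \<noteq> 0"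
    using not_relative_interior_at_edge[OF p(2), of "h 0" "h i" "w 0 p" "w i p", OF h0S p(1) hi g]
    by blast
  let ?c = "\<lambda>j. if j = 0 then \<alpha> else if j = i then \<beta> else 0"
  have h0: "h 0 p = 0" using p(1) S by blast
  have "(\<Sum>j\<le>n. ?c j *\<^sub>R w j p) = (\<Sum>j\<in>{0,i}. ?c j *\<^sub>R w j p)"
    by (rule sum.mono_neutral_right) (use i in auto)
  also have "\<dots> = 0" using i ab by simp
  finally have "\<And>j. j \<le> n \<Longrightarrow> ?c j = 0"
    using hi h0 by - (rule ind[OF p(1), of ?c], auto split: if_splits)
  from this[of 0] this[of i] show False using ab(2) i by auto
qed

end

text \<open>The sum s of two unit vectors at angle \<theta> has length 2 cos (\<theta> / 2), and its
  inner product with either of them is 1 + cos \<theta>; dividing gives cos (\<theta> / 2).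
  Reflection laws thus reduce to adding unit vectors.\<close>

lemma bisects_angle_unit_sum:
  fixes a b :: "'a::real_inner"
  assumes ab: "a \<noteq> 0" "b \<noteq> 0" and k: "k > 0" and w: "sgn a + sgn b = k *\<^sub>R w" "w \<noteq> 0"
  shows "bisects_angle (sgn w) a b"
proof -
  define c where "c = sgn a \<bullet> sgn b"
  have u: "norm (sgn a) = 1" "norm (sgn b) = 1" using ab by (auto simp: norm_sgn)
  have uu: "sgn a \<bullet> sgn a = 1" "sgn b \<bullet> sgn b = 1" using u by (auto simp: dot_square_norm)
  have c: "\<bar>c\<bar> \<le> 1" using Cauchy_Schwarz_ineq2[of "sgn a" "sgn b"] u by (simp add: c_def)
  define s where "s = sgn a + sgn b"
  have s0: "s \<noteq> 0" using k w by (simp add: s_def)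
  have "s \<bullet> s = 2 + 2 * c" using uu by (simp add: s_def c_def inner_add inner_commute)
  then have ns: "(norm s)\<^sup>2 = 2 + 2 * c" by (simp add: dot_square_norm)
  have sw: "sgn w = sgn s" using w k by (simp add: s_def sgn_scaleR)
  have nw: "norm (sgn w) = 1" using w(2) by (simp add: norm_sgn)
  have ss: "sgn (sgn s) = sgn s" using s0 by (simp add: sgn_div_norm)
  have inn: "x \<bullet> y / (norm x * norm y) = sgn x \<bullet> sgn y" for x y :: 'a
    by (simp add: sgn_div_norm divide_inverse)
  define \<theta> where "\<theta> = arccos c"
  have \<theta>: "0 \<le> \<theta>" "\<theta> \<le> pi" "cos \<theta> = c" using c by (auto simp: \<theta>_def arccos_lbound arccos_ubound cos_arccos)
  have "(1 + c) / norm s = norm s / 2"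
    using ns s0 by (simp add: field_simps power2_eq_square)
  moreover have "norm s = 2 * cos (\<theta> / 2)"
  proof (rule power2_eq_imp_eq)
    show "(norm s)\<^sup>2 = (2 * cos (\<theta> / 2))\<^sup>2"
      using ns \<theta>(3) cos_double_cos[of "\<theta> / 2"] by (simp add: power_mult_distrib)
    show "0 \<le> 2 * cos (\<theta> / 2)" using \<theta> by (simp add: cos_ge_zero)
  qed simp
  ultimately have half: "(1 + c) / norm s = cos (\<theta> / 2)" by simp
  have a1: "sgn a \<bullet> sgn s = (1 + c) / norm s" "sgn s \<bullet> sgn b = (1 + c) / norm s"
    using uu by (simp_all add: sgn_div_norm[of s]) (simp_all add: s_def inner_add c_def divide_inverse mult.commute add.commute)
  have arc: "arccos (cos (\<theta> / 2)) = \<theta> / 2" using \<theta> by (simp add: arccos_cos)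
  show ?thesis
    unfolding bisects_angle_def vec_angle_def inn sw ss a1 half arc c_def[symmetric]
    by (simp add: \<theta>_def)
qed

section \<open>The body\<close>

locale mirror_body =
  fixes e e' :: "'a::euclidean_space"
  assumes norm_e: "norm e = 1" and norm_e': "norm e' = 1" and orth: "e \<bullet> e' = 0"
begin

text \<open>\<open>ell x = s\<close> and \<open>hyp x = s\<close> are the polar equations of an ellipsoid and of a sheet of a
  hyperboloid with foci \<open>0\<close> and \<open>(4 / 3 * s) *\<^sub>R e\<close>. The cone \<open>azi x = 0\<close> with axis direction
  \<open>e'\<close> in the hyperplane orthogonal to \<open>e\<close> separates the two classes of meridian half-planes.\<close>

definition ell :: "'a \<Rightarrow> real" where "ell x = norm x - (x \<bullet> e) / 2"
definition hyp :: "'a \<Rightarrow> real" where "hyp x = 2 * (x \<bullet> e) - norm x"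
definition azi :: "'a \<Rightarrow> real" where "azi x = 4 * (x \<bullet> e')\<^sup>2 - (norm x)\<^sup>2 + (x \<bullet> e)\<^sup>2"

definition in_cone :: "'a \<Rightarrow> bool" where
  "in_cone x \<longleftrightarrow> 4 * hyp x < ell x \<and> ell x < 5 * hyp x"

definition between_mirrors :: "real \<Rightarrow> 'a \<Rightarrow> bool" where
  "between_mirrors s x \<longleftrightarrow> s < ell x \<and> hyp x < s"

definition double_mirror :: "real \<Rightarrow> 'a \<Rightarrow> bool" where
  "double_mirror s x \<longleftrightarrow> between_mirrors s x \<or> between_mirrors (6 * s) x"

text \<open>The last disjunct matters only where \<open>azi x = 0\<close>: it adds the interface
  points lying in pieces of both classes, through which the two sides are joined.\<close>

definition mbody :: "'a set" where
  "mbody = {x. in_cone x \<and>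
     (0 < azi x \<and> double_mirror 1 x \<or> azi x < 0 \<and> double_mirror 2 x \<or>
      double_mirror 1 x \<and> double_mirror 2 x)}"

lemmas double_mirror_defs = double_mirror_def between_mirrors_def

lemma ee: "e \<bullet> e = 1" "e' \<bullet> e' = 1" "e' \<bullet> e = 0"
  using norm_e norm_e' orth by (auto simp: dot_square_norm inner_commute)

lemma norm_eq: "norm x = (4 * ell x + hyp x) / 3"
  and inner_e_eq: "x \<bullet> e = 2 * (ell x + hyp x) / 3"
  by (auto simp: ell_def hyp_def)

lemma cone_pos: "in_cone x \<Longrightarrow> 0 < hyp x \<and> 0 < ell x"
  by (auto simp: in_cone_def)

lemma continuous_ell [continuous_intros]: "continuous_on S f \<Longrightarrow> continuous_on S (\<lambda>x. ell (f x))"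
  and continuous_hyp [continuous_intros]: "continuous_on S f \<Longrightarrow> continuous_on S (\<lambda>x. hyp (f x))"
  and continuous_azi [continuous_intros]: "continuous_on S f \<Longrightarrow> continuous_on S (\<lambda>x. azi (f x))"
  unfolding ell_def hyp_def azi_def by (auto intro!: continuous_intros)

lemma open_mbody: "open mbody"
  unfolding mbody_def in_cone_def double_mirror_defs
  by (intro open_Collect_conj open_Collect_disj open_Collect_less continuous_intros)

lemma bounded_mbody: "bounded mbody"
  unfolding bounded_iff
proof (intro exI ballI)
  fix x assume "x \<in> mbody"
  \<comment> \<open>In the body \<open>hyp x < 12\<close> and \<open>ell x < 60\<close>, so the norm
    is below (4 * 60 + 12) / 3 = 84; the bound is generous.\<close>
  then show "norm x \<le> 132"
    using norm_eq[of x] by (auto simp: mbody_def in_cone_def double_mirror_defs)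
qed

lemma origin_notin_closure: "0 \<notin> closure mbody"
proof
  assume "0 \<in> closure mbody"
  moreover have "closure mbody \<subseteq> {x. 1 \<le> ell x}"
  proof (rule closure_minimal)
    show "mbody \<subseteq> {x. 1 \<le> ell x}"
      by (auto simp: mbody_def in_cone_def double_mirror_defs)
    show "closed {x. 1 \<le> ell x}" by (intro closed_Collect_le continuous_intros)
  qed
  ultimately show False by (auto simp: ell_def)
qed

lemma ell_scale: "0 \<le> t \<Longrightarrow> ell (t *\<^sub>R x) = t * ell x"
  and hyp_scale: "0 \<le> t \<Longrightarrow> hyp (t *\<^sub>R x) = t * hyp x"
  by (auto simp: ell_def hyp_def algebra_simps)

lemma in_cone_scale: "0 < t \<Longrightarrow> in_cone (t *\<^sub>R x) \<longleftrightarrow> in_cone x"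
  by (auto simp: in_cone_def ell_scale hyp_scale)

text \<open>A norm plus a linear form is convex, and \<open>hyp\<close> is concave for the same
  reason. Together these control a whole light segment by its endpoints.\<close>

lemma ell_convex:
  assumes "y \<in> closed_segment p q" "ell p \<le> c" "ell q \<le> c"
  shows "ell y \<le> c"
proof -
  obtain t where t: "0 \<le> t" "t \<le> 1" "y = (1 - t) *\<^sub>R p + t *\<^sub>R q"
    using assms(1) by (auto simp: closed_segment_def)
  have ny: "norm y \<le> (1 - t) * norm p + t * norm q"
    using norm_triangle_ineq[of "(1 - t) *\<^sub>R p" "t *\<^sub>R q"] t by simp
  have ye: "y \<bullet> e = (1 - t) * (p \<bullet> e) + t * (q \<bullet> e)" by (simp add: t(3) inner_add_left)
  have "ell y \<le> (1 - t) * ell p + t * ell q"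
    unfolding ell_def ye using ny by (simp add: algebra_simps add_divide_distrib diff_divide_distrib)
  also have "\<dots> \<le> c" by (rule convex_bound_le) (use assms t in auto)
  finally show ?thesis .
qed

lemma hyp_concave:
  assumes "y \<in> closed_segment p q" "c \<le> hyp p" "c \<le> hyp q"
  shows "c \<le> hyp y"
proof -
  obtain t where t: "0 \<le> t" "t \<le> 1" "y = (1 - t) *\<^sub>R p + t *\<^sub>R q"
    using assms(1) by (auto simp: closed_segment_def)
  have ny: "norm y \<le> (1 - t) * norm p + t * norm q"
    using norm_triangle_ineq[of "(1 - t) *\<^sub>R p" "t *\<^sub>R q"] t by simp
  have ye: "y \<bullet> e = (1 - t) * (p \<bullet> e) + t * (q \<bullet> e)" by (simp add: t(3) inner_add_left)
  have *: "(1 - t) * hyp p + t * hyp q \<le> hyp y"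
    unfolding hyp_def ye using ny by (simp add: algebra_simps)
  have "(1 - t) * (- hyp p) + t * (- hyp q) \<le> - c"
    by (rule convex_bound_le) (use assms t in auto)
  with * show ?thesis by simp
qed

text \<open>On the positive half of the axis \<open>ell\<close> is only half of \<open>hyp\<close>,
  and on the negative half \<open>hyp\<close> is negative.\<close>

lemma not_in_cone_axis: "\<not> in_cone (a *\<^sub>R e)"
  by (auto simp: in_cone_def ell_def hyp_def ee norm_e abs_if)

text \<open>The form \<open>azi\<close> ignores the component along \<open>e\<close>. Its sign is
  therefore constant off the axis in each plane through the axis, so light, which stays in such a
  plane, meets pieces of one class only.\<close>

lemma azi_plane: "azi (a *\<^sub>R e + b *\<^sub>R d) = b\<^sup>2 * azi d"
  unfolding azi_def power2_norm_eq_inner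
  by (simp add: inner_add ee orth inner_commute[of e d] power2_eq_square algebra_simps)

text \<open>\<open>s\<close> is the size of the first pair of mirrors met by light in direction \<open>x\<close>.\<close>

definition lit :: "real \<Rightarrow> 'a \<Rightarrow> bool" where
  "lit s x \<longleftrightarrow> s = 1 \<and> 0 < azi x \<or> s = 2 \<and> azi x < 0"

lemma lit_scale:
  assumes "b \<noteq> 0"
  shows "lit s (a *\<^sub>R e + b *\<^sub>R d) \<longleftrightarrow> lit s d"
  unfolding lit_def azi_plane using assms by (auto simp: zero_less_mult_iff mult_less_0_iff)

lemma lit_pos: "lit s x \<Longrightarrow> 0 < s"
  by (auto simp: lit_def)

lemma mbody_lit: "lit s x \<Longrightarrow> x \<in> mbody \<longleftrightarrow> in_cone x \<and> double_mirror s x"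
  by (auto simp: lit_def mbody_def)

lemma notin_mbody_plane:
  assumes "lit s d" "y = a *\<^sub>R e + b *\<^sub>R d" "\<not> double_mirror s y"
  shows "y \<notin> mbody"
proof (cases "b = 0")
  case True
  then show ?thesis using not_in_cone_axis[of a] assms(2) by (auto simp: mbody_def)
next
  case False
  then show ?thesis using mbody_lit lit_scale assms by blast
qed

section \<open>Reflection in the axis and the passage through the second focus\<close>

definition refl :: "'a \<Rightarrow> 'a" where "refl d = (2 * (d \<bullet> e)) *\<^sub>R e - d"

lemma refl_inner: "refl d \<bullet> e = d \<bullet> e"
  by (simp add: refl_def inner_diff_left ee)

lemma norm_refl: "norm (refl d) = norm d"
proof -
  have "refl d \<bullet> refl d = d \<bullet> d"
    by (simp add: refl_def inner_diff ee inner_commute[of e d])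
  then show ?thesis by (simp add: norm_eq_sqrt_inner)
qed

lemma refl_refl: "refl (refl d) = d"
  by (simp add: refl_def inner_diff_left ee)

lemma ell_refl: "ell (refl d) = ell d" and hyp_refl: "hyp (refl d) = hyp d"
  by (simp_all add: ell_def hyp_def norm_refl refl_inner)

lemma in_cone_refl: "in_cone (refl d) \<longleftrightarrow> in_cone d"
  by (simp add: in_cone_def ell_refl hyp_refl)

lemma lit_refl: "lit s (refl d) \<longleftrightarrow> lit s d"
  using lit_scale[of "-1" s "2 * (d \<bullet> e)" d] by (simp add: refl_def)

text \<open>Here p is where the ray along d meets the ellipse, and q is the mirror image of where it
  meets the hyperbola. The weights cancel the denominators of p and q, leaving a multiple of
  \<open>d + refl d\<close>, which lies on the axis; its length comes out right because
  \<open>ell d + hyp d\<close> is 3 / 2 of \<open>d \<bullet> e\<close>.\<close>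

lemma focus_collinear:
  assumes d: "in_cone d" and F: "F = (4 / 3 * s) *\<^sub>R e" and s: "0 < s"
  defines "p \<equiv> (s / ell d) *\<^sub>R d" and "q \<equiv> (s / hyp d) *\<^sub>R refl d"
  shows "F = (ell d / (ell d + hyp d)) *\<^sub>R p + (hyp d / (ell d + hyp d)) *\<^sub>R q"
    (is "_ = ?r")
    "F \<in> closed_segment p q"
proof -
  have pos: "0 < hyp d" "0 < ell d" using cone_pos[OF d] by auto
  have "?r = (s / (ell d + hyp d)) *\<^sub>R (d + refl d)"
    using pos by (simp add: p_def q_def scaleR_add_right)
  also have "d + refl d = (4 / 3 * (ell d + hyp d)) *\<^sub>R e"
    by (simp add: refl_def inner_e_eq)
  finally have r: "?r = (s / (ell d + hyp d)) *\<^sub>R ((4 / 3 * (ell d + hyp d)) *\<^sub>R e)" .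
  have "(s / k) *\<^sub>R ((4 / 3 * k) *\<^sub>R e) = F" if "k > 0" for k :: real using that by (simp add: F)
  then have "?r = F" unfolding r using pos by (simp only: add_pos_pos)
  then show *: "F = ?r" ..
  have "hyp d / (ell d + hyp d) \<le> 1" "1 - hyp d / (ell d + hyp d) = ell d / (ell d + hyp d)"
    using pos by (auto simp: field_simps)
  then show "F \<in> closed_segment p q"
    unfolding * closed_segment_def using pos
    by (auto intro!: exI[of _ "hyp d / (ell d + hyp d)"])
qed

lemma closed_segment_through:
  assumes "F \<in> closed_segment p q" "y \<in> closed_segment p (q :: 'a)"
  shows "y \<in> closed_segment p F \<or> y \<in> closed_segment F q"
  using assms Un_closed_segment by blast

lemma segment_plane:
  assumes "y \<in> closed_segment (\<alpha> *\<^sub>R d) (\<beta> *\<^sub>R refl d)"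
  obtains a b where "y = a *\<^sub>R e + b *\<^sub>R d"
proof -
  obtain t where t: "y = (1 - t) *\<^sub>R (\<alpha> *\<^sub>R d) + t *\<^sub>R (\<beta> *\<^sub>R refl d)"
    using assms by (auto simp: closed_segment_def)
  show thesis
    by (rule that[of "t * \<beta> * (2 * (d \<bullet> e))" "(1 - t) * \<alpha> - t * \<beta>"])
       (simp add: t refl_def algebra_simps)
qed

text \<open>The segment is split at the focus F. Before F, convexity gives
  \<open>ell y \<le> t\<close> and concavity \<open>hyp y \<ge> t / 5\<close>; after F one has
  \<open>hyp y \<ge> t\<close> and \<open>ell y \<le> 5 * t\<close>. The first bound of each half
  excludes the piece of size t, and since 5 < 6 the two together exclude the other pair as
  well.\<close>

lemma stage_segment_avoids:
  assumes d: "in_cone d" "lit s d" and t: "t = s \<or> t = 6 * s"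
  shows "closed_segment ((t / ell d) *\<^sub>R d) ((t / hyp d) *\<^sub>R refl d) \<subseteq> - mbody"
proof
  fix y assume y: "y \<in> closed_segment ((t / ell d) *\<^sub>R d) ((t / hyp d) *\<^sub>R refl d)" (is "y \<in> closed_segment ?p ?q")
  have pos: "0 < hyp d" "0 < ell d" using cone_pos[OF d(1)] by auto
  have s: "0 < s" using d(2) by (rule lit_pos)
  have t0: "0 < t" using t s by auto
  define F where "F = (4 / 3 * t) *\<^sub>R e"
  have Fpq: "F \<in> closed_segment ?p ?q" by (rule focus_collinear(2)[OF d(1) F_def t0])
  have F: "ell F = 2 / 3 * t" "hyp F = 4 / 3 * t"
    using t0 by (simp_all add: ell_def hyp_def F_def ee norm_e)
  have p: "ell ?p = t" "hyp ?p = t * (hyp d / ell d)"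
    and q: "ell ?q = t * (ell d / hyp d)" "hyp ?q = t"
    using pos t0 by (simp_all add: ell_scale hyp_scale ell_refl hyp_refl)
  have "hyp d / ell d \<ge> 1 / 5" "ell d / hyp d \<le> 5"
    using d(1) pos by (auto simp: in_cone_def field_simps)
  then have p': "t / 5 \<le> hyp ?p" and q': "ell ?q \<le> 5 * t"
    using mult_left_mono[of "1 / 5" "hyp d / ell d" t] mult_left_mono[of "ell d / hyp d" 5 t] t0
    unfolding p q by auto
  have "\<not> double_mirror s y"
    using closed_segment_through[OF Fpq y]
  proof
    assume yF: "y \<in> closed_segment ?p F"
    have "ell y \<le> t" by (rule ell_convex[OF yF]) (use p F t0 in simp_all)
    moreover have "t / 5 \<le> hyp y" by (rule hyp_concave[OF yF p']) (use F t0 in simp)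
    ultimately show ?thesis using t s by (auto simp: double_mirror_defs)
  next
    assume yF: "y \<in> closed_segment F ?q"
    have "ell y \<le> 5 * t" by (rule ell_convex[OF yF _ q']) (use F t0 in simp)
    moreover have "t \<le> hyp y" by (rule hyp_concave[OF yF]) (use q F t0 in simp_all)
    ultimately show ?thesis using t s by (auto simp: double_mirror_defs)
  qed
  moreover obtain a b where "y = a *\<^sub>R e + b *\<^sub>R d" by (rule segment_plane[OF y])
  ultimately show "y \<in> - mbody" using notin_mbody_plane[OF d(2)] by simp
qed

lemma radial_avoids:
  assumes "lit s d" "y = r *\<^sub>R d" "\<not> double_mirror s y"
  shows "y \<notin> mbody"
  using notin_mbody_plane[OF assms(1), of y 0 r] assms by simp

section \<open>Gradients and outer normals\<close>

definition grad_ell :: "'a \<Rightarrow> 'a" where "grad_ell x = sgn x - (1 / 2) *\<^sub>R e"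
definition grad_hyp :: "'a \<Rightarrow> 'a" where "grad_hyp x = 2 *\<^sub>R e - sgn x"
definition grad_azi :: "'a \<Rightarrow> 'a" where
  "grad_azi x = (8 * (x \<bullet> e')) *\<^sub>R e' - 2 *\<^sub>R x + (2 * (x \<bullet> e)) *\<^sub>R e"

lemma GDERIV_ell: "x \<noteq> 0 \<Longrightarrow> GDERIV ell x :> grad_ell x"
  and GDERIV_hyp: "x \<noteq> 0 \<Longrightarrow> GDERIV hyp x :> grad_hyp x"
  unfolding gderiv_def ell_def[abs_def] hyp_def[abs_def] grad_ell_def grad_hyp_def
  by (auto intro!: derivative_eq_intros has_derivative_norm simp: inner_diff_right)

lemma GDERIV_azi: "GDERIV azi x :> grad_azi x"
  unfolding gderiv_def azi_def[abs_def] grad_azi_def power2_norm_eq_inner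
  by (rule has_derivative_eq_rhs, (rule derivative_intros)+)
    (simp add: fun_eq_iff inner_diff_right inner_add_right inner_commute[of x] algebra_simps)

lemma smooth_ell: "smooth_on ell (- {0})"
proof -
  have "smooth_on (\<lambda>x. norm x + (- 1 / 2) * (x \<bullet> e)) (- {0})"
    by (intro smooth_on_add smooth_on_mult smooth_on_const smooth_on_inner smooth_on_norm) auto
  then show ?thesis by (simp add: ell_def[abs_def])
qed

lemma smooth_hyp: "smooth_on hyp (- {0})"
proof -
  have "smooth_on (\<lambda>x. 2 * (x \<bullet> e) + (- 1) * norm x) (- {0})"
    by (intro smooth_on_add smooth_on_mult smooth_on_const smooth_on_inner smooth_on_norm) auto
  then show ?thesis by (simp add: hyp_def[abs_def])
qed

lemma smooth_azi: "smooth_on azi (- {0})"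
proof -
  have "smooth_on (\<lambda>x. (4 * ((x \<bullet> e') * (x \<bullet> e')) + (- 1) * (norm x * norm x)) + (x \<bullet> e) * (x \<bullet> e)) (- {0})"
    by (intro smooth_on_add smooth_on_mult smooth_on_const smooth_on_inner smooth_on_norm) auto
  then show ?thesis by (simp add: azi_def[abs_def] power2_eq_square)
qed

lemma open_in_cone: "open {x. in_cone x}"
  unfolding in_cone_def by (intro open_Collect_conj open_Collect_less continuous_intros)

lemma cone_nonzero: "in_cone x \<Longrightarrow> x \<noteq> 0"
  using not_in_cone_axis[of 0] by auto

lemma orth_part:
  assumes "0 < hyp x" "hyp x < 2 * ell x"
  shows "x - (x \<bullet> e) *\<^sub>R e \<noteq> 0"
proof
  assume "x - (x \<bullet> e) *\<^sub>R e = 0"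
  then have "norm x = norm ((x \<bullet> e) *\<^sub>R e)" by simp
  then have "norm x = \<bar>x \<bullet> e\<bar>" using norm_e by simp
  then show False using assms norm_eq[of x] inner_e_eq[of x] by simp
qed

text \<open>Off the axis the gradient cannot vanish: its component orthogonal to \<open>e\<close> is
  a multiple of a - b, and for a = b the terms \<open>sgn p\<close> cancel and (3 / 2) a e
  remains.\<close>

lemma outer_normal_affine:
  assumes p: "0 < hyp p" "hyp p < 2 * ell p" and U: "open U" "p \<in> U"
    and f: "a * ell p + b * hyp p + c = 0" "a \<noteq> 0 \<or> b \<noteq> 0"
    and B: "\<And>x. x \<in> U \<Longrightarrow> x \<in> B \<longleftrightarrow> a * ell x + b * hyp x + c < 0"
  shows "outer_normal_at B p (sgn (a *\<^sub>R grad_ell p + b *\<^sub>R grad_hyp p))"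
    "a *\<^sub>R grad_ell p + b *\<^sub>R grad_hyp p \<noteq> 0"
proof -
  have p0: "p \<noteq> 0" using p by (auto simp: hyp_def)
  show nz: "a *\<^sub>R grad_ell p + b *\<^sub>R grad_hyp p \<noteq> 0" (is "?w \<noteq> 0")
  proof
    assume *: "?w = 0"
    define q where "q = p - (p \<bullet> e) *\<^sub>R e"
    have q: "q \<noteq> 0" "q \<bullet> e = 0" using orth_part[OF p] by (auto simp: q_def inner_diff_left ee)
    have "q \<bullet> q = q \<bullet> (p - (p \<bullet> e) *\<^sub>R e)" by (simp add: q_def)
    then have qp: "q \<bullet> p = q \<bullet> q" using q(2) by (simp add: inner_diff_right)
    have w: "?w = (a - b) *\<^sub>R sgn p + (2 * b - a / 2) *\<^sub>R e"
      by (simp add: grad_ell_def grad_hyp_def algebra_simps)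
    have "q \<bullet> ?w = (a - b) * (inverse (norm p) * (q \<bullet> q))"
      unfolding w inner_add_right inner_scaleR_right q(2) sgn_div_norm qp by simp
    then have ab: "a = b" using * q(1) p0 by simp
    then have "(3 / 2 * a) *\<^sub>R e = 0" using w * by simp
    then show False using f(2) ab norm_e by auto
  qed
  let ?f = "\<lambda>x. a * ell x + b * hyp x + c"
  show "outer_normal_at B p (sgn ?w)"
    unfolding outer_normal_at_def
  proof (intro exI conjI)
    show "open (U \<inter> - {0})" "p \<in> U \<inter> - {0}" using U p0 by auto
    show "smooth_on ?f (U \<inter> - {0})"
      by (rule smooth_on_subset[of _ "- {0}"], intro smooth_on_add smooth_on_mult smooth_on_const smooth_ell smooth_hyp) auto
    show "?f p = 0" by fact
    show "GDERIV ?f p :> ?w"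
      using GDERIV_add[OF GDERIV_add[OF GDERIV_mult[OF GDERIV_const GDERIV_ell[OF p0]]
            GDERIV_mult[OF GDERIV_const GDERIV_hyp[OF p0]]] GDERIV_const] by simp
    show "?w \<noteq> 0" by (rule nz)
    show "B \<inter> (U \<inter> - {0}) = {x \<in> U \<inter> - {0}. ?f x < 0}" using B by auto
  qed simp
qed

lemma open_lit: "open {x. lit s x}"
  unfolding lit_def
  by (intro open_Collect_conj open_Collect_disj open_Collect_const open_Collect_less continuous_intros)

lemma outer_normal_ell:
  assumes p: "in_cone p" "lit s p" and t: "ell p = t" "t = s \<or> t = 6 * s"
  shows "outer_normal_at mbody p (sgn (- grad_ell p))" "grad_ell p \<noteq> 0"
proof -
  \<comment> \<open>The bounds t / 6 < hyp and ell < 6 t keep the other pair of mirrors of the same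
    class out of U, whether t is s or 6 s. Only the condition t < ell is left, hence the normal
    against the gradient.\<close>
  define U where "U = {x. lit s x} \<inter> {x. in_cone x} \<inter> {x. t / 6 < hyp x \<and> hyp x < t \<and> ell x < 6 * t}"
  have pos: "0 < hyp p" "0 < ell p" using cone_pos[OF p(1)] by auto
  have oU: "open U"
    unfolding U_def
    by (intro open_Int open_lit open_in_cone open_Collect_conj open_Collect_less continuous_intros)
  have pU: "p \<in> U" using p pos t(1) by (auto simp: U_def in_cone_def)
  have s: "0 < s" using p(2) by (rule lit_pos)
  have B: "x \<in> mbody \<longleftrightarrow> -1 * ell x + 0 * hyp x + t < 0" if "x \<in> U" for x
    using that t(2) s by (auto simp: U_def mbody_lit in_cone_def double_mirror_defs)
  have "0 < hyp p" "hyp p < 2 * ell p" using p pos by (auto simp: in_cone_def)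
  from outer_normal_affine[OF this oU pU _ _ B] t(1)
  show "outer_normal_at mbody p (sgn (- grad_ell p))" "grad_ell p \<noteq> 0" by auto
qed

lemma outer_normal_hyp:
  assumes p: "in_cone p" "lit s p" and t: "hyp p = t" "t = s \<or> t = 6 * s"
  shows "outer_normal_at mbody p (sgn (grad_hyp p))" "grad_hyp p \<noteq> 0"
proof -
  define U where "U = {x. lit s x} \<inter> {x. in_cone x} \<inter> {x. t / 6 < hyp x \<and> t < ell x \<and> ell x < 6 * t}"
  have pos: "0 < hyp p" "0 < ell p" using cone_pos[OF p(1)] by auto
  have oU: "open U"
    unfolding U_def
    by (intro open_Int open_lit open_in_cone open_Collect_conj open_Collect_less continuous_intros)
  have pU: "p \<in> U" using p pos t(1) by (auto simp: U_def in_cone_def)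
  have s: "0 < s" using p(2) by (rule lit_pos)
  have B: "x \<in> mbody \<longleftrightarrow> 0 * ell x + 1 * hyp x + (- t) < 0" if "x \<in> U" for x
    using that t(2) s by (auto simp: U_def mbody_lit in_cone_def double_mirror_defs)
  have "0 < hyp p" "hyp p < 2 * ell p" using p pos by (auto simp: in_cone_def)
  from outer_normal_affine[OF this oU pU _ _ B] t(1)
  show "outer_normal_at mbody p (sgn (grad_hyp p))" "grad_hyp p \<noteq> 0" by auto
qed

section \<open>Light rays\<close>

lemma sgn_eq_of_parallel:
  assumes "0 < k" "x = k *\<^sub>R (y::'a)"
  shows "sgn x = sgn y"
  using assms by (simp add: sgn_scaleR)

text \<open>The constant sum 8 / 3 t of the focal distances on the ellipse. Squares are compared, so
  the sign of the right side has to be secured by the bound on \<open>hyp p\<close>.\<close>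

lemma norm_from_ellipse_point:
  assumes "ell p = t" "hyp p \<le> t" "0 < t"
  shows "norm ((4 / 3 * t) *\<^sub>R e - p) = 8 / 3 * t - norm p"
proof (rule power2_eq_imp_eq)
  have pe: "p \<bullet> e = 2 * (norm p - t)" using assms(1) by (simp add: ell_def)
  have ep: "e \<bullet> p = 2 * (norm p - t)" using pe by (simp add: inner_commute)
  have "(norm ((4 / 3 * t) *\<^sub>R e - p))\<^sup>2 = (4 / 3 * t)\<^sup>2 - 2 * (4 / 3 * t) * (e \<bullet> p) + (norm p)\<^sup>2"
    unfolding power2_norm_eq_inner inner_diff_left inner_diff_right
      inner_scaleR_left inner_scaleR_right ee by (simp add: power2_eq_square inner_commute[of p e] field_simps)
  also have "\<dots> = (8 / 3 * t - norm p)\<^sup>2"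
    unfolding ep by (simp add: power2_eq_square algebra_simps)
  finally show "(norm ((4 / 3 * t) *\<^sub>R e - p))\<^sup>2 = (8 / 3 * t - norm p)\<^sup>2" .
  show "0 \<le> 8 / 3 * t - norm p" using norm_eq[of p] assms by simp
qed simp

text \<open>The constant difference 2 / 3 t of the focal distances on the branch nearer to the
  second focus.\<close>

lemma norm_from_hyperbola_point:
  assumes "hyp q = t" "t \<le> ell q" "0 < t"
  shows "norm ((4 / 3 * t) *\<^sub>R e - q) = norm q - 2 / 3 * t"
proof (rule power2_eq_imp_eq)
  have ep: "e \<bullet> q = (norm q + t) / 2" using assms(1) by (simp add: hyp_def inner_commute)
  have "(norm ((4 / 3 * t) *\<^sub>R e - q))\<^sup>2 = (4 / 3 * t)\<^sup>2 - 2 * (4 / 3 * t) * (e \<bullet> q) + (norm q)\<^sup>2"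
    unfolding power2_norm_eq_inner inner_diff_left inner_diff_right
      inner_scaleR_left inner_scaleR_right ee by (simp add: power2_eq_square inner_commute[of q e] field_simps)
  also have "\<dots> = (norm q - 2 / 3 * t)\<^sup>2"
    unfolding ep by (simp add: power2_eq_square algebra_simps add_divide_distrib)
  finally show "(norm ((4 / 3 * t) *\<^sub>R e - q))\<^sup>2 = (norm q - 2 / 3 * t)\<^sup>2" .
  show "0 \<le> norm q - 2 / 3 * t" using norm_eq[of q] assms by simp
qed simp

text \<open>The unit vectors from p towards the origin and towards F add up to a positive multiple
  of \<open>- grad_ell p\<close>, because the focal distances have sum 8 / 3 t. The light may come
  from any earlier point r d of its ray: the origin for the first pair, the preceding hyperbola for
  the second.\<close>

lemma bisects_at_ellipse:
  assumes d: "in_cone d" and t: "0 < t" and r: "r < t / ell d"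
  defines "p \<equiv> (t / ell d) *\<^sub>R d" and "q \<equiv> (t / hyp d) *\<^sub>R refl d"
  assumes nz: "grad_ell p \<noteq> 0"
  shows "bisects_angle (sgn (- grad_ell p)) (r *\<^sub>R d - p) (q - p)"
proof -
  have pos: "0 < hyp d" "0 < ell d" using cone_pos[OF d] by auto
  have d0: "d \<noteq> 0" by (rule cone_nonzero[OF d])
  define F where "F = (4 / 3 * t) *\<^sub>R e"
  define D where "D = norm (F - p)"
  have pt: "ell p = t" "hyp p \<le> t"
  proof -
    show "ell p = t" using pos t by (simp add: p_def ell_scale)
    have "hyp d / ell d \<le> 1" using d pos by (auto simp: in_cone_def)
    then show "hyp p \<le> t" using pos t mult_left_mono[of "hyp d / ell d" 1 t] by (simp add: p_def hyp_scale)
  qed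
  have D: "D = 8 / 3 * t - norm p"
    unfolding D_def F_def by (rule norm_from_ellipse_point[OF pt t])
  have D0: "0 < D" unfolding D using norm_eq[of p] pt t by simp
  have F: "F = (ell d / (ell d + hyp d)) *\<^sub>R p + (hyp d / (ell d + hyp d)) *\<^sub>R q"
    unfolding p_def q_def by (rule focus_collinear(1)[OF d F_def t])
  have "ell d / (ell d + hyp d) = 1 - hyp d / (ell d + hyp d)" using pos by (simp add: field_simps)
  moreover have "((1 - k) *\<^sub>R p + k *\<^sub>R q) - p = k *\<^sub>R (q - p)" for k :: real
    by (simp add: algebra_simps)
  ultimately have "F - p = (hyp d / (ell d + hyp d)) *\<^sub>R (q - p)"
    unfolding F by (simp only:)
  then have b: "sgn (F - p) = sgn (q - p)"
    by (rule sgn_eq_of_parallel[rotated]) (use pos in simp)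
  have "r *\<^sub>R d - p = (t / ell d - r) *\<^sub>R (- d)" by (simp add: p_def algebra_simps)
  then have a: "sgn (r *\<^sub>R d - p) = - sgn d"
    by (subst sgn_eq_of_parallel[of "t / ell d - r" _ "- d"]) (use r in \<open>auto simp: sgn_minus\<close>)
  have sp: "sgn p = sgn d" by (rule sgn_eq_of_parallel[of "t / ell d"]) (use pos t in \<open>auto simp: p_def\<close>)
  have Fp: "F - p = (4 / 3 * t) *\<^sub>R e - norm p *\<^sub>R sgn p"
    by (cases "p = 0") (simp_all add: F_def sgn_div_norm)
  have "sgn (r *\<^sub>R d - p) + sgn (q - p) = - sgn p + inverse D *\<^sub>R (F - p)"
    unfolding a b[symmetric] sp by (simp add: sgn_div_norm[of "F - p"] D_def)
  also have "\<dots> = inverse D *\<^sub>R ((4 / 3 * t) *\<^sub>R e - (D + norm p) *\<^sub>R sgn p)"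
    unfolding Fp using D0 by (simp add: algebra_simps)
  also have "D + norm p = 8 / 3 * t" by (simp add: D)
  also have "(4 / 3 * t) *\<^sub>R e - (8 / 3 * t) *\<^sub>R sgn p = (8 / 3 * t) *\<^sub>R (- grad_ell p)"
    by (simp add: grad_ell_def scaleR_diff_right)
  also have "inverse D *\<^sub>R \<dots> = (8 / 3 * t / D) *\<^sub>R (- grad_ell p)"
    by (simp only: scaleR_scaleR divide_inverse mult.commute)
  finally have sum: "sgn (r *\<^sub>R d - p) + sgn (q - p) = (8 / 3 * t / D) *\<^sub>R (- grad_ell p)" .
  show ?thesis
  proof (rule bisects_angle_unit_sum[OF _ _ _ sum])
    show "r *\<^sub>R d - p \<noteq> 0" using a d0 by (metis neg_equal_0_iff_equal sgn_zero_iff)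
    show "q - p \<noteq> 0" using b D0 by (metis D_def less_irrefl norm_zero sgn_zero_iff)
    show "0 < 8 / 3 * t / D" using t D0 by simp
    show "- grad_ell p \<noteq> 0" using nz by simp
  qed
qed

text \<open>As at the ellipse, now with the difference 2 / 3 t of the focal distances: the light
  comes from F and departs radially, so the unit vectors towards F and away from the origin are
  added. Any later point of the outgoing ray may stand for r.\<close>

lemma bisects_at_hyperbola:
  assumes d: "in_cone d" and t: "0 < t" and r: "t / hyp d < r"
  defines "p \<equiv> (t / ell d) *\<^sub>R d" and "q \<equiv> (t / hyp d) *\<^sub>R refl d"
  assumes nz: "grad_hyp q \<noteq> 0"
  shows "bisects_angle (sgn (grad_hyp q)) (p - q) (r *\<^sub>R refl d - q)"
proof -
  have pos: "0 < hyp d" "0 < ell d" using cone_pos[OF d] by auto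
  have d0: "refl d \<noteq> 0" using cone_nonzero d in_cone_refl by blast
  define F where "F = (4 / 3 * t) *\<^sub>R e"
  define D where "D = norm (F - q)"
  have qt: "hyp q = t" "t \<le> ell q"
  proof -
    show "hyp q = t" using pos t by (simp add: q_def hyp_scale hyp_refl)
    have "1 \<le> ell d / hyp d" using d pos by (auto simp: in_cone_def)
    then show "t \<le> ell q"
      using pos t mult_left_mono[of 1 "ell d / hyp d" t] by (simp add: q_def ell_scale ell_refl)
  qed
  have D: "D = norm q - 2 / 3 * t"
    unfolding D_def F_def by (rule norm_from_hyperbola_point[OF qt t])
  have D0: "0 < D" unfolding D using norm_eq[of q] qt t by simp
  have F: "F = (ell d / (ell d + hyp d)) *\<^sub>R p + (hyp d / (ell d + hyp d)) *\<^sub>R q"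
    unfolding p_def q_def by (rule focus_collinear(1)[OF d F_def t])
  have "hyp d / (ell d + hyp d) = 1 - ell d / (ell d + hyp d)" using pos by (simp add: field_simps)
  moreover have "(k *\<^sub>R p + (1 - k) *\<^sub>R q) - q = k *\<^sub>R (p - q)" for k :: real
    by (simp add: algebra_simps)
  ultimately have "F - q = (ell d / (ell d + hyp d)) *\<^sub>R (p - q)"
    unfolding F by (simp only:)
  then have b: "sgn (F - q) = sgn (p - q)"
    by (rule sgn_eq_of_parallel[rotated]) (use pos in simp)
  have "r *\<^sub>R refl d - q = (r - t / hyp d) *\<^sub>R refl d" by (simp add: q_def algebra_simps)
  then have a: "sgn (r *\<^sub>R refl d - q) = sgn (refl d)"
    by (rule sgn_eq_of_parallel[rotated]) (use r in simp)
  have sq: "sgn q = sgn (refl d)"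
    by (rule sgn_eq_of_parallel[of "t / hyp d"]) (use pos t in \<open>auto simp: q_def\<close>)
  have Fq: "F - q = (4 / 3 * t) *\<^sub>R e - norm q *\<^sub>R sgn q"
    by (cases "q = 0") (simp_all add: F_def sgn_div_norm)
  have "sgn (p - q) + sgn (r *\<^sub>R refl d - q) = inverse D *\<^sub>R (F - q) + sgn q"
    unfolding a b[symmetric] sq by (simp add: sgn_div_norm[of "F - q"] D_def)
  also have "\<dots> = inverse D *\<^sub>R ((4 / 3 * t) *\<^sub>R e - (norm q - D) *\<^sub>R sgn q)"
    unfolding Fq using D0 by (simp add: algebra_simps)
  also have "norm q - D = 2 / 3 * t" by (simp add: D)
  also have "(4 / 3 * t) *\<^sub>R e - (2 / 3 * t) *\<^sub>R sgn q = (2 / 3 * t) *\<^sub>R grad_hyp q"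
    by (simp add: grad_hyp_def scaleR_diff_right)
  also have "inverse D *\<^sub>R \<dots> = (2 / 3 * t / D) *\<^sub>R grad_hyp q"
    by (simp only: scaleR_scaleR divide_inverse mult.commute)
  finally have sum: "sgn (p - q) + sgn (r *\<^sub>R refl d - q) = (2 / 3 * t / D) *\<^sub>R grad_hyp q" .
  show ?thesis
  proof (rule bisects_angle_unit_sum[OF _ _ _ sum nz])
    show "r *\<^sub>R refl d - q \<noteq> 0" using a d0 by (metis sgn_zero_iff)
    show "p - q \<noteq> 0" using b D0 by (metis D_def less_irrefl norm_zero sgn_zero_iff)
    show "0 < 2 / 3 * t / D" using t D0 by simp
  qed
qed

lemma radial_segment:
  assumes "y \<in> closed_segment (a *\<^sub>R d) (b *\<^sub>R (d::'a))" "a \<le> b"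
  obtains r where "y = r *\<^sub>R d" "a \<le> r" "r \<le> b"
proof -
  obtain u where u: "0 \<le> u" "u \<le> 1" "y = (1 - u) *\<^sub>R (a *\<^sub>R d) + u *\<^sub>R (b *\<^sub>R d)"
    using assms(1) by (auto simp: closed_segment_def)
  show thesis
  proof (rule that)
    show "y = (a + u * (b - a)) *\<^sub>R d" by (simp add: u(3) algebra_simps)
    show "a \<le> a + u * (b - a)" using u assms(2) by simp
    show "a + u * (b - a) \<le> b" using mult_left_le_one_le[of "b - a" u] u assms(2) by simp
  qed
qed

lemma trajectory_in_cone:
  assumes d: "in_cone d" "lit s d"
  obtains x where "billiard_trajectory mbody 0 x 4"
    "line_segment x 4 0 \<subseteq> ray 0 d" "line_segment x 4 4 \<subseteq> ray 0 d"
proof -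
  have s: "0 < s" using d(2) by (rule lit_pos)
  define d' where "d' = refl d"
  have d': "in_cone d'" "lit s d'" "refl d' = d" "refl d = d'"
    using d by (simp_all add: d'_def in_cone_refl lit_refl refl_refl)
  define A where "A = ell d"
  define G where "G = hyp d"
  have AG: "0 < G" "0 < A" "4 * G < A" "A < 5 * G"
    using cone_pos[OF d(1)] d(1) by (auto simp: A_def G_def in_cone_def)
  have AG': "ell d = A" "hyp d = G" "ell d' = A" "hyp d' = G"
    by (simp_all add: A_def G_def d'_def ell_refl hyp_refl)
  have d0: "d \<noteq> 0" "d' \<noteq> 0" using cone_nonzero d d' by auto
  \<comment> \<open>The second inequality amounts to A < 6 G: the first hyperbola is passed before
    the second ellipse is reached.\<close>
  have sa: "s / A < s / G" "s / G < 6 * s / A" "6 * s / A < 6 * s / G" "6 * s / G < 12 * s / G" "0 < s / A"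
    using AG s by (auto simp: field_simps)
  \<comment> \<open>The reflections occur at the ellipse and hyperbola of size s, then at those of
    size 6 s with the roles of d and d' exchanged. The last point merely fixes the direction of the
    infinite segment; any point further out would do.\<close>
  define x :: "nat \<Rightarrow> 'a" where "x = (\<lambda>i. if i = 0 then 0 else if i = 1 then (s / A) *\<^sub>R d
    else if i = 2 then (s / G) *\<^sub>R d' else if i = 3 then (6 * s / A) *\<^sub>R d'
    else if i = 4 then (6 * s / G) *\<^sub>R d else (12 * s / G) *\<^sub>R d)"
  have x: "x 0 = 0" "x 1 = (s / A) *\<^sub>R d" "x (Suc 0) = (s / A) *\<^sub>R d" "x 2 = (s / G) *\<^sub>R d'"
    "x 3 = (6 * s / A) *\<^sub>R d'" "x 4 = (6 * s / G) *\<^sub>R d" "x 5 = (12 * s / G) *\<^sub>R d"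
    by (simp_all add: x_def)
  have hA: "r * A \<le> t" if "r \<le> t / A" for r t using that AG by (simp add: field_simps)
  have hG: "t \<le> r * G" if "t / G \<le> r" for r t using that AG by (simp add: field_simps)
  have tail: "x 5 - x 4 = (6 * s / G) *\<^sub>R d"
    unfolding x by (simp flip: scaleR_diff_left)
  have last: "line_segment x 4 4 = {r *\<^sub>R d | r. 6 * s / G \<le> r}"
  proof -
    have "(6 * s / G) *\<^sub>R d + u *\<^sub>R (x 5 - x 4) = ((1 + u) * (6 * s / G)) *\<^sub>R d" for u
      unfolding tail by (simp only: distrib_right mult_1_left scaleR_add_left scaleR_scaleR)
    moreover have "(\<exists>u\<ge>0. r = (1 + u) * (6 * s / G)) \<longleftrightarrow> 6 * s / G \<le> r" for r
    proof
      assume "6 * s / G \<le> r"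
      then show "\<exists>u\<ge>0. r = (1 + u) * (6 * s / G)"
        using s AG by (intro exI[of _ "r * G / (6 * s) - 1"]) (simp add: field_simps)
    next
      assume "\<exists>u\<ge>0. r = (1 + u) * (6 * s / G)"
      then obtain u where u: "u \<ge> 0" "r = (1 + u) * (6 * s / G)" by blast
      have "1 * (6 * s / G) \<le> (1 + u) * (6 * s / G)" using u s AG by (intro mult_right_mono) auto
      then show "6 * s / G \<le> r" using u by simp
    qed
    ultimately show ?thesis
      unfolding line_segment_def ray_def by (simp add: x) (metis (no_types, opaque_lifting))
  qed
  have first: "line_segment x 4 0 = closed_segment 0 ((s / A) *\<^sub>R d)"
    by (simp add: line_segment_def x)
  have n1: "outer_normal_at mbody (x 1) (sgn (- grad_ell (x 1)))" "grad_ell (x 1) \<noteq> 0"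
    unfolding x by (rule outer_normal_ell[of _ s s];
        use d lit_scale[of "s / A" s 0 d] AG s in \<open>simp add: in_cone_scale ell_scale AG'\<close>)+
  have n2: "outer_normal_at mbody (x 2) (sgn (grad_hyp (x 2)))" "grad_hyp (x 2) \<noteq> 0"
    unfolding x by (rule outer_normal_hyp[of _ s s];
        use d' lit_scale[of "s / G" s 0 d'] AG s in \<open>simp add: in_cone_scale hyp_scale AG'\<close>)+
  have n3: "outer_normal_at mbody (x 3) (sgn (- grad_ell (x 3)))" "grad_ell (x 3) \<noteq> 0"
    unfolding x by (rule outer_normal_ell[of _ s "6 * s"];
        use d' lit_scale[of "6 * s / A" s 0 d'] AG s in \<open>simp add: in_cone_scale ell_scale AG'\<close>)+
  have n4: "outer_normal_at mbody (x 4) (sgn (grad_hyp (x 4)))" "grad_hyp (x 4) \<noteq> 0"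
    unfolding x by (rule outer_normal_hyp[of _ s "6 * s"];
        use d lit_scale[of "6 * s / G" s 0 d] AG s in \<open>simp add: in_cone_scale hyp_scale AG'\<close>)+
  have b1: "bisects_angle (sgn (- grad_ell (x 1))) (x 0 - x 1) (x 2 - x 1)"
    using bisects_at_ellipse[OF d(1) s, of 0] n1(2) sa by (simp add: x AG' d'(4))
  have b2: "bisects_angle (sgn (grad_hyp (x 2))) (x 1 - x 2) (x 3 - x 2)"
    using bisects_at_hyperbola[OF d(1) s, of "6 * s / A"] n2(2) sa by (simp add: x AG' d'(4))
  have b3: "bisects_angle (sgn (- grad_ell (x 3))) (x 2 - x 3) (x 4 - x 3)"
    using bisects_at_ellipse[OF d'(1), of "6 * s" "s / G"] n3(2) sa s by (simp add: x AG' d'(3))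
  have b4: "bisects_angle (sgn (grad_hyp (x 4))) (x 3 - x 4) (x 5 - x 4)"
    using bisects_at_hyperbola[OF d'(1), of "6 * s" "12 * s / G"] n4(2) sa s by (simp add: x AG' d'(3))
  have le4: "i = 0 \<or> i = 1 \<or> i = 2 \<or> i = 3 \<or> i = 4" if "i \<le> 4" for i :: nat
    using that by presburger
  have s0: "line_segment x 4 0 \<subseteq> - mbody"
  proof
    fix y assume "y \<in> line_segment x 4 0"
    then have "y \<in> closed_segment (0 *\<^sub>R d) ((s / A) *\<^sub>R d)" by (simp add: first)
    then obtain r where r: "y = r *\<^sub>R d" "0 \<le> r" "r \<le> s / A"
      by (rule radial_segment) (use sa in simp)
    then have "\<not> double_mirror s y"
      using hA[OF r(3)] s by (simp add: double_mirror_defs ell_scale AG')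
    then show "y \<in> - mbody" using radial_avoids[OF d(2) r(1)] by simp
  qed
  have s1: "line_segment x 4 1 \<subseteq> - mbody"
    using stage_segment_avoids[OF d, of s] by (simp add: line_segment_def x AG' d'(4) numeral_2_eq_2[symmetric])
  have s2: "line_segment x 4 2 \<subseteq> - mbody"
  proof
    fix y assume "y \<in> line_segment x 4 2"
    then have "y \<in> closed_segment ((s / G) *\<^sub>R d') ((6 * s / A) *\<^sub>R d')"
      by (simp add: line_segment_def x)
    then obtain r where r: "y = r *\<^sub>R d'" "s / G \<le> r" "r \<le> 6 * s / A"
      by (rule radial_segment) (use sa in simp)
    have "0 \<le> s / G" using s AG by simp
    then have "0 \<le> r" using r by linarith
    then have "\<not> double_mirror s y"
      using hA[OF r(3)] hG[OF r(2)] s by (simp add: double_mirror_defs ell_scale hyp_scale AG' r(1))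
    then show "y \<in> - mbody" using radial_avoids[OF d'(2) r(1)] by simp
  qed
  have s3: "line_segment x 4 3 \<subseteq> - mbody"
    using stage_segment_avoids[OF d'(1,2), of "6 * s"] by (simp add: line_segment_def x AG' d'(3))
  have s4: "line_segment x 4 4 \<subseteq> - mbody"
  proof
    fix y assume "y \<in> line_segment x 4 4"
    then obtain r where r: "y = r *\<^sub>R d" "6 * s / G \<le> r" by (auto simp: last)
    have "0 \<le> 6 * s / G" using s AG by simp
    then have "0 \<le> r" using r by linarith
    then have "\<not> double_mirror s y"
      using hG[OF r(2)] s by (simp add: double_mirror_defs hyp_scale AG' r(1))
    then show "y \<in> - mbody" using radial_avoids[OF d(2) r(1)] by simp
  qed
  have ne: "x i \<noteq> x (Suc i)" if "i \<le> 4" for i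
  proof -
    \<comment> \<open>Consecutive vertices are distinct because \<open>ell\<close> increases
      strictly along them.\<close>
    have "s * 1 < s * (A / G)" using s AG by (intro mult_strict_left_mono) auto
    moreover have "s * (A / G) < s * 5" using s AG by (intro mult_strict_left_mono) (auto simp: field_simps)
    moreover have "ell (x 0) = 0" "ell (x 1) = s" "ell (x 2) = s * (A / G)" "ell (x 3) = 6 * s"
      "ell (x 4) = 6 * (s * (A / G))" "ell (x 5) = 12 * (s * (A / G))"
      unfolding x using AG s by (simp_all add: ell_scale AG') (simp add: ell_def)
    ultimately have "ell (x 0) < ell (x 1)" "ell (x 1) < ell (x 2)" "ell (x 2) < ell (x 3)"
      "ell (x 3) < ell (x 4)" "ell (x 4) < ell (x 5)"
      using s by linarith+
    then have step: "x 0 \<noteq> x 1" "x 1 \<noteq> x 2" "x 2 \<noteq> x 3" "x 3 \<noteq> x 4" "x 4 \<noteq> x 5"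
      by auto
    have "Suc 0 = 1" "Suc 1 = 2" "Suc 2 = 3" "Suc 3 = 4" "Suc 4 = 5" by auto
    with le4[OF that] step show ?thesis by metis
  qed
  have "billiard_trajectory mbody 0 x 4"
    unfolding billiard_trajectory_def
  proof (intro conjI allI impI ballI)
    show "x 0 = 0" by (simp add: x)
    show "x i \<noteq> x (Suc i)" if "i \<le> 4" for i by (rule ne[OF that])
    show "line_segment x 4 i \<subseteq> - mbody" if "i \<le> 4" for i
      using le4[OF that] s0 s1 s2 s3 s4 by auto
    show "\<exists>n. outer_normal_at mbody (x i) n \<and> bisects_angle n (x (i - 1) - x i) (x (i + 1) - x i)"
      if i: "i \<in> {1..4}" for i
    proof -
      consider "i = 1" | "i = 2" | "i = 3" | "i = 4" using i by fastforce
      then show ?thesis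
      proof cases
        case 1
        then show ?thesis using n1(1) b1 by (auto simp: numeral_2_eq_2)
      next
        case 2
        then show ?thesis using n2(1) b2 by auto
      next
        case 3
        then show ?thesis using n3(1) b3 by auto
      next
        case 4
        then show ?thesis using n4(1) b4 by auto
      qed
    qed
  qed
  moreover have "line_segment x 4 0 \<subseteq> ray 0 d"
  proof
    fix y assume "y \<in> line_segment x 4 0"
    then have "y \<in> closed_segment (0 *\<^sub>R d) ((s / A) *\<^sub>R d)" by (simp add: first)
    then obtain r where "y = r *\<^sub>R d" "0 \<le> r" "r \<le> s / A"
      by (rule radial_segment) (use sa in simp)
    then show "y \<in> ray 0 d" by (auto simp: ray_def)
  qed
  moreover have "line_segment x 4 4 \<subseteq> ray 0 d"
  proof -
    have "0 \<le> 6 * s / G" using s AG by simp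
    then show ?thesis unfolding last ray_def by (auto intro: order_trans)
  qed
  ultimately show thesis by (rule that)
qed

lemma trajectory_outside_cone:
  assumes d: "\<not> in_cone d" "d \<noteq> 0"
  defines "x \<equiv> \<lambda>i::nat. if i = 0 then 0 else d"
  shows "billiard_trajectory mbody 0 x 0" "line_segment x 0 0 \<subseteq> ray 0 d"
proof -
  have seg: "line_segment x 0 0 = ray 0 d" by (simp add: line_segment_def x_def)
  then show "line_segment x 0 0 \<subseteq> ray 0 d" by simp
  have "y \<notin> mbody" if y: "y \<in> ray 0 d" for y
  proof -
    obtain t where t: "0 \<le> t" "y = t *\<^sub>R d" using y by (auto simp: ray_def)
    then have "\<not> in_cone y"
      using in_cone_scale[of t d] d(1) not_in_cone_axis[of 0] by (cases "t = 0") auto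
    then show ?thesis by (simp add: mbody_def)
  qed
  then show "billiard_trajectory mbody 0 x 0"
    using seg d(2) by (auto simp: billiard_trajectory_def x_def)
qed

section \<open>Almost every direction\<close>

lemma azi_eq: "azi x = (2 * (x \<bullet> e'))\<^sup>2 - (norm (x - (x \<bullet> e) *\<^sub>R e))\<^sup>2"
  unfolding azi_def power2_norm_eq_inner inner_diff_left inner_diff_right
    inner_scaleR_left inner_scaleR_right ee
  by (simp add: power2_eq_square inner_commute[of e x])

text \<open>The zero set of \<open>azi\<close> is a double cone, contained in the frontiers of the
  two convex solid cones K 1 and K (-1); frontiers of convex sets are negligible.\<close>

lemma negligible_azi: "negligible {x. azi x = 0}"
proof -
  define K where "K = (\<lambda>\<sigma>::real. {x. norm (x - (x \<bullet> e) *\<^sub>R e) \<le> 2 * \<sigma> * (x \<bullet> e')})"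
  have conv: "convex (K \<sigma>)" for \<sigma>
  proof (rule convexI)
    fix x y :: 'a and a b :: real
    assume h: "x \<in> K \<sigma>" "y \<in> K \<sigma>" "0 \<le> a" "0 \<le> b" "a + b = 1"
    have "norm ((a *\<^sub>R x + b *\<^sub>R y) - ((a *\<^sub>R x + b *\<^sub>R y) \<bullet> e) *\<^sub>R e) =
        norm (a *\<^sub>R (x - (x \<bullet> e) *\<^sub>R e) + b *\<^sub>R (y - (y \<bullet> e) *\<^sub>R e))"
      by (simp add: inner_add_left algebra_simps)
    also have "\<dots> \<le> a * norm (x - (x \<bullet> e) *\<^sub>R e) + b * norm (y - (y \<bullet> e) *\<^sub>R e)"
      using norm_triangle_ineq[of "a *\<^sub>R (x - (x \<bullet> e) *\<^sub>R e)" "b *\<^sub>R (y - (y \<bullet> e) *\<^sub>R e)"] h by simp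
    also have "\<dots> \<le> a * (2 * \<sigma> * (x \<bullet> e')) + b * (2 * \<sigma> * (y \<bullet> e'))"
      using h by (intro add_mono mult_left_mono) (auto simp: K_def)
    finally show "a *\<^sub>R x + b *\<^sub>R y \<in> K \<sigma>"
      by (simp add: K_def inner_add_left algebra_simps)
  qed
  have fr: "x \<in> frontier (K \<sigma>)" if x: "norm (x - (x \<bullet> e) *\<^sub>R e) = 2 * \<sigma> * (x \<bullet> e')" and \<sigma>: "\<bar>\<sigma>\<bar> = 1" for x \<sigma>
  proof -
    have "x \<notin> interior (K \<sigma>)"
    proof
      assume "x \<in> interior (K \<sigma>)"
      then obtain \<epsilon> where \<epsilon>: "0 < \<epsilon>" "cball x \<epsilon> \<subseteq> K \<sigma>" by (meson mem_interior_cball)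
      \<comment> \<open>Moving by \<epsilon> against \<sigma> e' lowers the right side of the
        inequality defining K by 2 \<epsilon>, but the left side by at most \<epsilon>, so y leaves
        the cone.\<close>
      define y where "y = x - (\<sigma> * \<epsilon>) *\<^sub>R e'"
      have "dist x y = \<epsilon>" using \<epsilon>(1) \<sigma> norm_e' by (simp add: y_def dist_norm abs_mult)
      then have yK: "y \<in> K \<sigma>" using \<epsilon>(2) by auto
      have ye: "y - (y \<bullet> e) *\<^sub>R e = (x - (x \<bullet> e) *\<^sub>R e) - (\<sigma> * \<epsilon>) *\<^sub>R e'"
        by (simp add: y_def inner_diff_left ee)
      have \<sigma>2: "\<sigma> * \<sigma> = 1" using \<sigma> by (auto simp: abs_if split: if_splits)
      have "norm (x - (x \<bullet> e) *\<^sub>R e) - \<epsilon> \<le> norm (y - (y \<bullet> e) *\<^sub>R e)"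
        using norm_triangle_ineq2[of "x - (x \<bullet> e) *\<^sub>R e" "(\<sigma> * \<epsilon>) *\<^sub>R e'"] \<epsilon>(1) \<sigma> norm_e'
        unfolding ye by (simp add: abs_mult)
      also have "\<dots> \<le> 2 * \<sigma> * (y \<bullet> e')" using yK by (simp add: K_def)
      also have "\<dots> = 2 * \<sigma> * (x \<bullet> e') - 2 * \<epsilon>"
        using \<sigma>2 by (simp add: y_def inner_diff_left ee algebra_simps)
      finally show False using x \<epsilon>(1) by simp
    qed
    moreover have "x \<in> closure (K \<sigma>)" using x closure_subset[of "K \<sigma>"] by (auto simp: K_def)
    ultimately show ?thesis by (simp add: frontier_def)
  qed
  have "{x. azi x = 0} \<subseteq> frontier (K 1) \<union> frontier (K (- 1))"
  proof
    fix x assume "x \<in> {x. azi x = 0}"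
    then have "(norm (x - (x \<bullet> e) *\<^sub>R e))\<^sup>2 = (2 * (x \<bullet> e'))\<^sup>2" by (simp add: azi_eq)
    then have "norm (x - (x \<bullet> e) *\<^sub>R e) = 2 * (x \<bullet> e') \<or>
        norm (x - (x \<bullet> e) *\<^sub>R e) = - (2 * (x \<bullet> e'))"
      by (simp only: power2_eq_iff)
    then show "x \<in> frontier (K 1) \<union> frontier (K (- 1))" using fr[of x 1] fr[of x "-1"] by auto
  qed
  then show ?thesis
    using negligible_convex_frontier[OF conv] by (meson negligible_Un negligible_subset)
qed

lemma invisible: "invisible_from mbody 0"
  unfolding invisible_from_def
proof (intro conjI origin_notin_closure)
  define N where "N = {u \<in> sphere 0 1. azi u = 0}"
  have cl: "closed {x. azi x = 0}" by (intro closed_Collect_eq continuous_intros)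
  have N: "N = sphere 0 1 \<inter> {x. azi x = 0}" by (auto simp: N_def)
  then have Nb: "N \<in> sets borel" using cl by (auto intro!: borel_closed)
  have Ns: "N \<in> sets sphere_measure" using Nb by (auto simp: sets_sphere_measure sets_restrict_space N)
  have null: "emeasure lborel {x. azi x = 0} = 0"
  proof -
    have "emeasure lebesgue {x. azi x = 0} = 0"
      using negligible_azi negligible_iff_null_sets by (auto simp: null_sets_def)
    then show ?thesis using cl by (simp add: emeasure_completion borel_closed)
  qed
  \<comment> \<open>The form \<open>azi\<close> is homogeneous, so the cone over the exceptional
    directions stays inside its zero set.\<close>
  have "{t *\<^sub>R u | t u. 0 < t \<and> t < 1 \<and> u \<in> N} \<subseteq> {x. azi x = 0}"
    using azi_plane[of 0] by (auto simp: N_def)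
  then have "emeasure lborel {t *\<^sub>R u | t u. 0 < t \<and> t < 1 \<and> u \<in> N} \<le> 0"
    using emeasure_mono[of _ "{x. azi x = 0}" lborel] null borel_closed[OF cl] by simp
  then have N0: "emeasure sphere_measure N = 0"
    using emeasure_sphere_measure[OF Nb] N by simp
  show "AE u in sphere_measure. \<exists>x m. billiard_trajectory mbody 0 x m \<and>
      line_segment x m 0 \<subseteq> ray 0 u \<and> line_segment x m m \<subseteq> ray 0 u"
  proof (rule AE_I[OF _ N0 Ns], rule subsetI, rule ccontr)
    fix u assume u: "u \<in> {u \<in> space sphere_measure. \<not> (\<exists>x m. billiard_trajectory mbody 0 x m \<and>
      line_segment x m 0 \<subseteq> ray 0 u \<and> line_segment x m m \<subseteq> ray 0 u)}" "u \<notin> N"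
    then have u1: "norm u = 1" by (simp add: space_sphere_measure)
    then have "azi u \<noteq> 0" using u(2) by (simp add: N_def)
    then obtain s where "lit s u" by (auto simp: lit_def linorder_neq_iff)
    then show False
    proof (cases "in_cone u")
      case True
      obtain x where "billiard_trajectory mbody 0 x 4"
        "line_segment x 4 0 \<subseteq> ray 0 u" "line_segment x 4 4 \<subseteq> ray 0 u"
        by (rule trajectory_in_cone[OF True \<open>lit s u\<close>])
      then show False using u(1) by blast
    next
      case False
      have "u \<noteq> 0" using u1 by auto
      then show False using u(1) trajectory_outside_cone[OF False] by blast
    qed
  qed
qed

section \<open>The boundary of the body\<close>

lemma gradients_independent:
  assumes p: "0 < hyp p" "hyp p < 2 * ell p" and z: "z = 0 \<or> azi p = 0"
    and sum: "a *\<^sub>R grad_ell p + b *\<^sub>R grad_hyp p + z *\<^sub>R grad_azi p = 0"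
  shows "a = 0" "b = 0" "z = 0"
proof -
  have p0: "p \<noteq> 0" using p by (auto simp: hyp_def)
  define q where "q = p - (p \<bullet> e) *\<^sub>R e"
  define v where "v = p \<bullet> e'"
  define k where "k = (a - b) * inverse (norm p) - 2 * z"
  have q: "q \<noteq> 0" "q \<bullet> e = 0" "q \<bullet> e' = v"
    using orth_part[OF p] by (auto simp: q_def v_def inner_diff_left ee orth)
  have "q \<bullet> q = q \<bullet> (p - (p \<bullet> e) *\<^sub>R e)" by (simp add: q_def)
  then have qp: "q \<bullet> p = q \<bullet> q" using q(2) by (simp add: inner_diff_right)
  have "q \<bullet> (a *\<^sub>R grad_ell p + b *\<^sub>R grad_hyp p + z *\<^sub>R grad_azi p) = k * (q \<bullet> q) + 8 * z * v * v"
    unfolding grad_ell_def grad_hyp_def grad_azi_def sgn_div_norm inner_add_right inner_diff_right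
      inner_scaleR_right q qp k_def v_def by (simp add: algebra_simps)
  then have 1: "k * (q \<bullet> q) + 8 * z * v * v = 0" unfolding sum by simp
  have "e' \<bullet> (a *\<^sub>R grad_ell p + b *\<^sub>R grad_hyp p + z *\<^sub>R grad_azi p) = k * v + 8 * z * v"
    unfolding grad_ell_def grad_hyp_def grad_azi_def sgn_div_norm inner_add_right inner_diff_right
      inner_scaleR_right ee k_def v_def inner_commute[of e' p] by (simp add: algebra_simps)
  then have 2: "k * v + 8 * z * v = 0" unfolding sum by simp
  have "q \<bullet> q \<noteq> 0" using q by simp
  have z0: "z = 0"
  proof (rule ccontr)
    assume "z \<noteq> 0"
    then have "azi p = 0" using z by simp
    then have "(norm q)\<^sup>2 = (2 * v)\<^sup>2" by (simp add: azi_eq q_def v_def)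
    then have qq: "q \<bullet> q = 4 * (v * v)"
      unfolding power2_norm_eq_inner by (simp add: power2_eq_square)
    then have v: "v \<noteq> 0" using \<open>q \<bullet> q \<noteq> 0\<close> by auto
    have "(k + 8 * z) * v = 0" using 2 by (simp add: algebra_simps)
    then have k: "k = - 8 * z" using v by simp
    have "z * (v * v) = 0" using 1 unfolding qq k by (simp add: algebra_simps)
    then show False using v \<open>z \<noteq> 0\<close> by simp
  qed
  then show "z = 0" .
  have "k = 0" using 1 z0 q by simp
  then have ab: "a = b" using z0 p0 by (simp add: k_def)
  have "a *\<^sub>R grad_ell p + b *\<^sub>R grad_hyp p = (3 / 2 * a) *\<^sub>R e"
    unfolding ab grad_ell_def grad_hyp_def by (simp add: algebra_simps flip: scaleR_add_left)
  then have "(3 / 2 * a) *\<^sub>R e = 0" using sum z0 by simp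
  then show "a = 0" "b = 0" using ab norm_e by auto
qed

text \<open>One shape for all defining functions, so that a piece of the boundary is given by a
  table of coefficients.\<close>

definition lev :: "real \<Rightarrow> real \<Rightarrow> real \<Rightarrow> real \<Rightarrow> 'a \<Rightarrow> real" where
  "lev a b q c x = a * ell x + b * hyp x + q * azi x + c"

definition closed_cone :: "'a \<Rightarrow> bool" where
  "closed_cone x \<longleftrightarrow> 4 * hyp x \<le> ell x \<and> ell x \<le> 5 * hyp x"

text \<open>The three basic gradients are independent, so independence of active gradients reduces
  to that of coefficient vectors. For \<open>grad_azi\<close> this is known only on the interface;
  by \<open>wf\<close> a function involving \<open>azi\<close> is a pure multiple of it, hence
  active only there.\<close>

lemma smooth_polytope_piece_lev:
  fixes a b q c :: "nat \<Rightarrow> real"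
  defines "h \<equiv> \<lambda>i. lev (a i) (b i) (q i) (c i)"
  assumes S: "S = {x. h 0 x = 0 \<and> (\<forall>i\<in>{1..n}. 0 \<le> h i x)}"
    and region: "\<And>x. x \<in> S \<Longrightarrow> closed_cone x \<and> 0 < hyp x \<and> hyp x \<le> 12"
    and wf: "\<And>i. i \<le> n \<Longrightarrow> q i \<noteq> 0 \<Longrightarrow> a i = 0 \<and> b i = 0 \<and> c i = 0"
    and ind: "\<And>p k. p \<in> S \<Longrightarrow> (\<And>i. i \<le> n \<Longrightarrow> h i p \<noteq> 0 \<Longrightarrow> k i = 0) \<Longrightarrow>
      (\<Sum>i\<le>n. k i * a i) = 0 \<Longrightarrow> (\<Sum>i\<le>n. k i * b i) = 0 \<Longrightarrow> (\<Sum>i\<le>n. k i * q i) = 0 \<Longrightarrow>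
      \<forall>i\<le>n. k i = 0"
  shows "smooth_polytope_piece h n (- {0}) S
    (\<lambda>i x. a i *\<^sub>R grad_ell x + b i *\<^sub>R grad_hyp x + q i *\<^sub>R grad_azi x)"
proof
  have nz: "x \<noteq> 0" if "x \<in> S" for x using region[OF that] by (auto simp: hyp_def)
  show "open (- {0::'a})" by auto
  show "smooth_on (h i) (- {0})" for i
    unfolding h_def lev_def[abs_def]
    by (intro smooth_on_add smooth_on_mult smooth_on_const smooth_ell smooth_hyp smooth_azi) auto
  show "GDERIV (h i) x :> a i *\<^sub>R grad_ell x + b i *\<^sub>R grad_hyp x + q i *\<^sub>R grad_azi x"
    if "x \<in> - {0}" for i x
  proof -
    have x: "x \<noteq> 0" using that by simp
    show ?thesis
      unfolding h_def lev_def[abs_def]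
      using GDERIV_add[OF GDERIV_add[OF GDERIV_add[OF GDERIV_mult[OF GDERIV_const GDERIV_ell[OF x]]
            GDERIV_mult[OF GDERIV_const GDERIV_hyp[OF x]]]
            GDERIV_mult[OF GDERIV_const GDERIV_azi]] GDERIV_const]
      by simp
  qed
  show "S = {x \<in> - {0}. h 0 x = 0 \<and> (\<forall>i\<in>{1..n}. 0 \<le> h i x)}"
    using nz S by blast
  show "compact S"
    unfolding compact_eq_bounded_closed
  proof
    show "bounded S"
      unfolding bounded_iff
    proof (intro exI ballI)
      fix x assume "x \<in> S"
      from region[OF this] show "norm x \<le> 84" using norm_eq[of x] by (simp add: closed_cone_def)
    qed
    have "closed {x. h i x = 0}" "closed {x. 0 \<le> h i x}" for i
      unfolding h_def lev_def
      by (intro closed_Collect_eq closed_Collect_le continuous_intros)+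
    then show "closed S"
      unfolding S Ball_def by (intro closed_Collect_conj closed_Collect_all closed_Collect_imp open_Collect_const)
  qed
  fix p k i
  assume p: "p \<in> S" and act: "\<And>i. i \<le> n \<Longrightarrow> h i p \<noteq> 0 \<Longrightarrow> k i = (0::real)"
    and sum: "(\<Sum>i\<le>n. k i *\<^sub>R (a i *\<^sub>R grad_ell p + b i *\<^sub>R grad_hyp p + q i *\<^sub>R grad_azi p)) = 0"
    and i: "i \<le> n"
  let ?a = "\<Sum>i\<le>n. k i * a i" and ?b = "\<Sum>i\<le>n. k i * b i" and ?q = "\<Sum>i\<le>n. k i * q i"
  have "?a *\<^sub>R grad_ell p + ?b *\<^sub>R grad_hyp p + ?q *\<^sub>R grad_azi p = 0"
    using sum by (simp add: scaleR_sum_left scaleR_add_right sum.distrib)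
  moreover have "?q = 0 \<or> azi p = 0"
  proof (rule disjCI)
    assume Q: "azi p \<noteq> 0"
    show "?q = 0"
    proof (rule sum.neutral, rule ballI)
      fix i assume i: "i \<in> {..n}"
      show "k i * q i = 0"
      proof (cases "q i = 0")
        case False
        then have "h i p \<noteq> 0" using wf[of i] i Q by (simp add: h_def lev_def)
        then show ?thesis using act[of i] i by simp
      qed simp
    qed
  qed
  moreover have "0 < hyp p" "hyp p < 2 * ell p" using region[OF p] by (auto simp: closed_cone_def)
  ultimately have "?a = 0" "?b = 0" "?q = 0" using gradients_independent by blast+
  then show "k i = 0" using ind[OF p, of k] act i by blast
qed

definition good_piece :: "'a set \<Rightarrow> bool" where
  "good_piece S \<longleftrightarrow> smooth_piece S \<and> (\<forall>p\<in>S. hypersurface_corner_at 0 S p \<longrightarrow> regular_point mbody p)"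

lemma det_zero:
  fixes x y :: real
  assumes "x * a + y * b = 0" "x * c + y * d = 0" "a * d \<noteq> b * c"
  shows "x = 0 \<and> y = 0"
proof -
  have "x * (a * d - b * c) = (x * a + y * b) * d - (x * c + y * d) * b"
    and "y * (a * d - b * c) = (x * c + y * d) * a - (x * a + y * b) * c"
    by (simp_all add: algebra_simps)
  then have "x * (a * d - b * c) = 0" "y * (a * d - b * c) = 0" unfolding assms(1,2) by simp_all
  then show ?thesis using assms(3) by simp
qed

text \<open>The part, on one side of \<open>{azi = 0}\<close>, of the boundary over an edge of a polygon in the
  \<open>(ell, hyp)\<close>-plane.\<close>

lemma good_piece_side:
  fixes a0 :: real
  assumes S_eq: "S = {x. lev a0 b0 0 c0 x = 0 \<and> 0 \<le> lev a1 b1 0 c1 x \<and> 0 \<le> lev a2 b2 0 c2 x \<and> 0 \<le> \<sigma> * azi x}"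
    and region: "\<And>x. x \<in> S \<Longrightarrow> closed_cone x \<and> 0 < hyp x \<and> hyp x \<le> 12"
    and det: "a0 * b1 \<noteq> a1 * b0" "a0 * b2 \<noteq> a2 * b0" and \<sigma>: "\<sigma> \<noteq> 0"
    and ends: "\<And>x. x \<in> S \<Longrightarrow> lev a1 b1 0 c1 x \<noteq> 0 \<or> lev a2 b2 0 c2 x \<noteq> 0"
    and reg: "\<And>x. lev a0 b0 0 c0 x = 0 \<Longrightarrow> 0 < lev a1 b1 0 c1 x \<Longrightarrow> 0 < lev a2 b2 0 c2 x \<Longrightarrow>
      0 < \<sigma> * azi x \<Longrightarrow> regular_point mbody x"
  shows "good_piece S"
proof -
  define a where "a = (\<lambda>i::nat. if i = 0 then a0 else if i = 1 then a1 else if i = 2 then a2 else 0)"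
  define b where "b = (\<lambda>i::nat. if i = 0 then b0 else if i = 1 then b1 else if i = 2 then b2 else 0)"
  define c where "c = (\<lambda>i::nat. if i = 0 then c0 else if i = 1 then c1 else if i = 2 then c2 else 0)"
  define q where "q = (\<lambda>i::nat. if i = 3 then \<sigma> else 0)"
  have set3: "{1..3} = {1, 2, 3::nat}" "{..3} = {0, 1, 2, 3::nat}" by auto
  note abcq = a_def b_def c_def q_def
  interpret smooth_polytope_piece "\<lambda>i. lev (a i) (b i) (q i) (c i)" 3 "- {0}" S
    "\<lambda>i x. a i *\<^sub>R grad_ell x + b i *\<^sub>R grad_hyp x + q i *\<^sub>R grad_azi x"
  proof (rule smooth_polytope_piece_lev)
    show "S = {x. lev (a 0) (b 0) (q 0) (c 0) x = 0 \<and> (\<forall>i\<in>{1..3}. 0 \<le> lev (a i) (b i) (q i) (c i) x)}"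
      unfolding S_eq set3 by (simp add: abcq) (simp add: lev_def)
    show "\<And>x. x \<in> S \<Longrightarrow> closed_cone x \<and> 0 < hyp x \<and> hyp x \<le> 12" by (rule region)
    show "\<And>i. i \<le> 3 \<Longrightarrow> q i \<noteq> 0 \<Longrightarrow> a i = 0 \<and> b i = 0 \<and> c i = 0" by (simp add: abcq split: if_splits)
    fix p k
    assume p: "p \<in> S" and act: "\<And>i. i \<le> 3 \<Longrightarrow> lev (a i) (b i) (q i) (c i) p \<noteq> 0 \<Longrightarrow> k i = (0::real)"
      and sums: "(\<Sum>i\<le>3. k i * a i) = 0" "(\<Sum>i\<le>3. k i * b i) = 0" "(\<Sum>i\<le>3. k i * q i) = 0"
    have sa: "k 0 * a0 + k 1 * a1 + k 2 * a2 = 0" and sb: "k 0 * b0 + k 1 * b1 + k 2 * b2 = 0"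
      and sq: "k 3 * \<sigma> = 0"
      using sums unfolding set3 by (simp_all add: abcq algebra_simps)
    have k3: "k 3 = 0" using sq \<sigma> by simp
    \<comment> \<open>The two ends of an edge are never active together, so one of their
      coefficients vanishes and a two by two system remains.\<close>
    have "k 1 = 0 \<or> k 2 = 0" using ends[OF p] act[of 1] act[of 2] by (auto simp: abcq)
    then have "k 0 = 0 \<and> k 1 = 0 \<and> k 2 = 0"
    proof
      assume k: "k 1 = 0"
      show ?thesis using det_zero[of "k 0" a0 "k 2" a2 b0 b2] sa sb k det by (simp add: mult.commute)
    next
      assume k: "k 2 = 0"
      show ?thesis using det_zero[of "k 0" a0 "k 1" a1 b0 b1] sa sb k det by (simp add: mult.commute)
    qed
    moreover have "i = 0 \<or> i = 1 \<or> i = 2 \<or> i = 3" if "i \<le> 3" for i :: nat using that by presburger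
    ultimately show "\<forall>i\<le>3. k i = 0" using k3 by metis
  qed
  show ?thesis
    unfolding good_piece_def
  proof (intro conjI ballI impI smooth_piece)
    fix p assume p: "p \<in> S" "hypersurface_corner_at 0 S p"
    show "regular_point mbody p"
    proof (rule reg)
      show "lev a0 b0 0 c0 p = 0" using p(1) by (simp add: S_eq)
      show "0 < lev a1 b1 0 c1 p" using relative_interior_pos[OF p, of 1] by (simp add: abcq)
      show "0 < lev a2 b2 0 c2 p" using relative_interior_pos[OF p, of 2] by (simp add: abcq)
      show "0 < \<sigma> * azi p" using relative_interior_pos[OF p, of 3] by (simp add: abcq lev_def)
    qed
  qed
qed

text \<open>The piece lies over a polygon with two sides on the cone and two further sides. The
  conditions \<open>det\<close> say that the latter are transversal to the lines with directions (4,
  1) and (5, 1) in the plane of \<open>ell\<close> and \<open>hyp\<close>; \<sigma> tells on which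
  side of the interface the body lies.\<close>

lemma good_piece_interface:
  fixes a1 :: real
  assumes S_eq: "S = {x. azi x = 0 \<and> closed_cone x \<and> 0 \<le> lev a1 b1 0 c1 x \<and> 0 \<le> lev a2 b2 0 c2 x}"
    and region: "\<And>x. x \<in> S \<Longrightarrow> 0 < hyp x \<and> hyp x \<le> 12"
    and det: "4 * a1 + b1 \<noteq> 0" "5 * a1 + b1 \<noteq> 0" "4 * a2 + b2 \<noteq> 0" "5 * a2 + b2 \<noteq> 0"
    and ends: "\<And>x. x \<in> S \<Longrightarrow> lev a1 b1 0 c1 x \<noteq> 0 \<or> lev a2 b2 0 c2 x \<noteq> 0"
    and \<sigma>: "\<sigma> = 1 \<or> \<sigma> = - 1"
    and reg: "\<And>x. in_cone x \<Longrightarrow> 0 < lev a1 b1 0 c1 x \<Longrightarrow> 0 < lev a2 b2 0 c2 x \<Longrightarrow>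
      x \<in> mbody \<longleftrightarrow> \<sigma> * azi x < 0"
  shows "good_piece S"
proof -
  define a where "a = (\<lambda>i::nat. if i = 0 then 0 else if i = 1 then 1 else if i = 2 then - 1 else if i = 3 then a1 else a2)"
  define b where "b = (\<lambda>i::nat. if i = 0 then 0 else if i = 1 then - 4 else if i = 2 then 5 else if i = 3 then b1 else b2)"
  define c where "c = (\<lambda>i::nat. if i = 0 then 0 else if i = 1 then 0 else if i = 2 then 0 else if i = 3 then c1 else c2)"
  define q where "q = (\<lambda>i::nat. if i = 0 then 1 else 0 :: real)"
  have set4: "{1..4} = {1, 2, 3, 4::nat}" "{..4} = {0, 1, 2, 3, 4::nat}" by auto
  note abcq = a_def b_def c_def q_def
  interpret smooth_polytope_piece "\<lambda>i. lev (a i) (b i) (q i) (c i)" 4 "- {0}" S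
    "\<lambda>i x. a i *\<^sub>R grad_ell x + b i *\<^sub>R grad_hyp x + q i *\<^sub>R grad_azi x"
  proof (rule smooth_polytope_piece_lev)
    show "S = {x. lev (a 0) (b 0) (q 0) (c 0) x = 0 \<and> (\<forall>i\<in>{1..4}. 0 \<le> lev (a i) (b i) (q i) (c i) x)}"
      unfolding S_eq set4 by (simp add: abcq) (auto simp: lev_def closed_cone_def)
    show "\<And>x. x \<in> S \<Longrightarrow> closed_cone x \<and> 0 < hyp x \<and> hyp x \<le> 12" using region S_eq by auto
    show "\<And>i. i \<le> 4 \<Longrightarrow> q i \<noteq> 0 \<Longrightarrow> a i = 0 \<and> b i = 0 \<and> c i = 0" by (simp add: abcq split: if_splits)
    fix p k
    assume p: "p \<in> S" and act: "\<And>i. i \<le> 4 \<Longrightarrow> lev (a i) (b i) (q i) (c i) p \<noteq> 0 \<Longrightarrow> k i = (0::real)"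
      and sums: "(\<Sum>i\<le>4. k i * a i) = 0" "(\<Sum>i\<le>4. k i * b i) = 0" "(\<Sum>i\<le>4. k i * q i) = 0"
    have sa: "k 1 - k 2 + k 3 * a1 + k 4 * a2 = 0" and sb: "- 4 * k 1 + 5 * k 2 + k 3 * b1 + k 4 * b2 = 0"
      and k0: "k 0 = 0"
      using sums unfolding set4 by (simp_all add: abcq algebra_simps)
    have k34: "k 3 = 0 \<or> k 4 = 0" using ends[OF p] act[of 3] act[of 4] by (auto simp: abcq)
    have "0 < hyp p" using region[OF p] by simp
    then have "lev 1 (- 4) 0 0 p \<noteq> 0 \<or> lev (- 1) 5 0 0 p \<noteq> 0" by (simp add: lev_def)
    then have k12: "k 1 = 0 \<or> k 2 = 0" using act[of 1] act[of 2] by (auto simp: abcq)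
    have D: "k 1 * 1 + y * \<alpha> = 0 \<Longrightarrow> k 1 * - 4 + y * \<beta> = 0 \<Longrightarrow> 4 * \<alpha> + \<beta> \<noteq> 0 \<Longrightarrow> k 1 = 0 \<and> y = 0"
      "k 2 * - 1 + y * \<alpha> = 0 \<Longrightarrow> k 2 * 5 + y * \<beta> = 0 \<Longrightarrow> 5 * \<alpha> + \<beta> \<noteq> 0 \<Longrightarrow> k 2 = 0 \<and> y = 0" for y \<alpha> \<beta>
      using det_zero[of "k 1" 1 y \<alpha> "- 4" \<beta>] det_zero[of "k 2" "- 1" y \<alpha> 5 \<beta>] by auto
    have "k 1 = 0 \<and> k 2 = 0 \<and> k 3 = 0 \<and> k 4 = 0"
      using k12 k34 sa sb D(1)[of "k 3" a1 b1] D(1)[of "k 4" a2 b2] D(2)[of "k 3" a1 b1] D(2)[of "k 4" a2 b2] det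
      by (elim disjE) auto
    moreover have "i = 0 \<or> i = 1 \<or> i = 2 \<or> i = 3 \<or> i = 4" if "i \<le> 4" for i :: nat using that by presburger
    ultimately show "\<forall>i\<le>4. k i = 0" using k0 by metis
  qed
  show ?thesis
    unfolding good_piece_def
  proof (intro conjI ballI impI smooth_piece)
    fix p assume p: "p \<in> S" "hypersurface_corner_at 0 S p"
    have pos: "0 < lev (a i) (b i) (q i) (c i) p" if "i \<in> {1..4}" for i
      by (rule relative_interior_pos[OF p that])
    have cone: "in_cone p" using pos[of 1] pos[of 2] by (simp add: abcq lev_def in_cone_def)
    have l: "0 < lev a1 b1 0 c1 p" "0 < lev a2 b2 0 c2 p"
      using pos[of 3] pos[of 4] by (simp_all add: abcq)
    have Q: "azi p = 0" using p(1) by (simp add: S_eq)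
    have p0: "p \<noteq> 0" by (rule cone_nonzero[OF cone])
    define U where "U = {x. in_cone x} \<inter> {x. 0 < lev a1 b1 0 c1 x \<and> 0 < lev a2 b2 0 c2 x} \<inter> - {0}"
    have "0 < hyp p" "hyp p < 2 * ell p" using cone cone_pos[OF cone] by (auto simp: in_cone_def)
    then have g: "grad_azi p \<noteq> 0" using gradients_independent[of p 1 0 0] Q by auto
    show "regular_point mbody p"
      unfolding regular_point_def outer_normal_at_def
    proof (intro exI conjI)
      show "open U"
        unfolding U_def lev_def
        by (intro open_Int open_in_cone open_Collect_conj open_Collect_less continuous_intros)
      show "p \<in> U" using cone l p0 by (simp add: U_def)
      show "smooth_on (\<lambda>x. \<sigma> * azi x) U"
        by (rule smooth_on_subset[of _ "- {0}"], intro smooth_on_mult smooth_on_const smooth_azi)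
          (auto simp: U_def)
      show "\<sigma> * azi p = 0" using Q by simp
      show "GDERIV (\<lambda>x. \<sigma> * azi x) p :> \<sigma> *\<^sub>R grad_azi p"
        using GDERIV_mult[OF GDERIV_const GDERIV_azi] by simp
      show "\<sigma> *\<^sub>R grad_azi p \<noteq> 0" using g \<sigma> by auto
      show "mbody \<inter> U = {x \<in> U. \<sigma> * azi x < 0}" using reg by (auto simp: U_def)
    qed simp
  qed
qed

lemma regular_point_cone_face:
  assumes p: "lit s p" "t = s \<or> t = 6 * s" "t < ell p" "hyp p < t"
    and f: "ell p = 4 * hyp p \<or> ell p = 5 * hyp p"
  shows "regular_point mbody p"
proof -
  have s: "0 < s" using p(1) by (rule lit_pos)
  have h: "0 < hyp p" using f p(2,3) s by auto
  then have h': "0 < hyp p" "hyp p < 2 * ell p" using f by auto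
  have dm: "double_mirror s x" if "t < ell x" "hyp x < t" for x
    using that p(2) by (auto simp: double_mirror_defs)
  from f show ?thesis
  proof
    assume f: "ell p = 4 * hyp p"
    define U where "U = {x. lit s x} \<inter> {x. t < ell x \<and> hyp x < t \<and> ell x < 5 * hyp x}"
    have oU: "open U"
      unfolding U_def by (intro open_Int open_lit open_Collect_conj open_Collect_less continuous_intros)
    have pU: "p \<in> U" using p f h by (simp add: U_def)
    have "x \<in> mbody \<longleftrightarrow> -1 * ell x + 4 * hyp x + 0 < 0" if "x \<in> U" for x
      using that dm[of x] by (auto simp: U_def mbody_lit in_cone_def)
    from outer_normal_affine(1)[OF h' oU pU _ _ this] f show ?thesis
      by (auto simp: regular_point_def)
  next
    assume f: "ell p = 5 * hyp p"
    define U where "U = {x. lit s x} \<inter> {x. t < ell x \<and> hyp x < t \<and> 4 * hyp x < ell x}"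
    have oU: "open U"
      unfolding U_def by (intro open_Int open_lit open_Collect_conj open_Collect_less continuous_intros)
    have pU: "p \<in> U" using p f h by (simp add: U_def)
    have "x \<in> mbody \<longleftrightarrow> 1 * ell x + (- 5) * hyp x + 0 < 0" if "x \<in> U" for x
      using that dm[of x] by (auto simp: U_def mbody_lit in_cone_def)
    from outer_normal_affine(1)[OF h' oU pU _ _ this] f show ?thesis
      by (auto simp: regular_point_def)
  qed
qed

text \<open>Triples of the size \<open>s\<close> of the first pair of mirrors, the sign of \<open>azi\<close> where this size
  occurs, and the size of either pair.\<close>

definition level :: "(real \<times> real \<times> real) set" where
  "level = {(1, 1, 1), (1, 1, 6), (2, - 1, 2), (2, - 1, 12)}"

lemma level_iff: "(s, \<sigma>, t) \<in> level \<longleftrightarrow> (s = 1 \<and> \<sigma> = 1 \<or> s = 2 \<and> \<sigma> = - 1) \<and> (t = s \<or> t = 6 * s)"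
  by (auto simp: level_def)

lemma level_lit: "(s, \<sigma>, t) \<in> level \<Longrightarrow> 0 < \<sigma> * azi x \<Longrightarrow> lit s x"
  by (auto simp: level_iff lit_def)

definition ell_face :: "real \<times> real \<times> real \<Rightarrow> 'a set" where
  "ell_face = (\<lambda>(s, \<sigma>, t). {x. ell x = t \<and> closed_cone x \<and> 0 \<le> \<sigma> * azi x})"
definition hyp_face :: "real \<times> real \<times> real \<Rightarrow> 'a set" where
  "hyp_face = (\<lambda>(s, \<sigma>, t). {x. hyp x = t \<and> closed_cone x \<and> 0 \<le> \<sigma> * azi x})"
definition cone_face_4 :: "real \<times> real \<times> real \<Rightarrow> 'a set" where
  "cone_face_4 = (\<lambda>(s, \<sigma>, t). {x. ell x = 4 * hyp x \<and> t \<le> ell x \<and> hyp x \<le> t \<and> 0 \<le> \<sigma> * azi x})"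
definition cone_face_5 :: "real \<times> real \<times> real \<Rightarrow> 'a set" where
  "cone_face_5 = (\<lambda>(s, \<sigma>, t). {x. ell x = 5 * hyp x \<and> t \<le> ell x \<and> hyp x \<le> t \<and> 0 \<le> \<sigma> * azi x})"

text \<open>Along the cone the walls follow in the order ell = 1, ell = 2, hyp = 1, ell = 6, hyp =
  2, ell = 12, hyp = 6, hyp = 12. The four cases are the stretches where exactly one class has
  material, alternately the first and the second.\<close>

definition interface :: "nat \<Rightarrow> 'a set" where
  "interface i = {x. azi x = 0 \<and> closed_cone x \<and>
     (if i = 0 then 1 \<le> ell x \<and> ell x \<le> 2 else if i = 1 then 1 \<le> hyp x \<and> ell x \<le> 6
      else if i = 2 then 2 \<le> hyp x \<and> ell x \<le> 12 else 6 \<le> hyp x \<and> hyp x \<le> 12)}"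

lemma good_ell_face: "l \<in> level \<Longrightarrow> good_piece (ell_face l)"
proof -
  assume "l \<in> level"
  then obtain s \<sigma> t where l: "l = (s, \<sigma>, t)" "(s, \<sigma>, t) \<in> level" by (metis prod_cases3)
  show ?thesis
  proof (rule good_piece_side[of _ 1 0 "- t" 1 "- 4" 0 "- 1" 5 0 \<sigma>])
    show "ell_face l = {x. lev 1 0 0 (- t) x = 0 \<and> 0 \<le> lev 1 (- 4) 0 0 x \<and> 0 \<le> lev (- 1) 5 0 0 x \<and> 0 \<le> \<sigma> * azi x}"
      by (auto simp: l(1) ell_face_def lev_def closed_cone_def)
    show "regular_point mbody x" if "lev 1 0 0 (- t) x = 0" "0 < lev 1 (- 4) 0 0 x"
      "0 < lev (- 1) 5 0 0 x" "0 < \<sigma> * azi x" for x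
      using outer_normal_ell(1)[of x s t] that level_lit[OF l(2)] l(2)
      by (auto simp: lev_def in_cone_def regular_point_def level_iff)
  qed (use l(2) in \<open>auto simp: l(1) level_iff ell_face_def closed_cone_def lev_def\<close>)
qed

lemma good_hyp_face: "l \<in> level \<Longrightarrow> good_piece (hyp_face l)"
proof -
  assume "l \<in> level"
  then obtain s \<sigma> t where l: "l = (s, \<sigma>, t)" "(s, \<sigma>, t) \<in> level" by (metis prod_cases3)
  show ?thesis
  proof (rule good_piece_side[of _ 0 1 "- t" 1 "- 4" 0 "- 1" 5 0 \<sigma>])
    show "hyp_face l = {x. lev 0 1 0 (- t) x = 0 \<and> 0 \<le> lev 1 (- 4) 0 0 x \<and> 0 \<le> lev (- 1) 5 0 0 x \<and> 0 \<le> \<sigma> * azi x}"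
      by (auto simp: l(1) hyp_face_def lev_def closed_cone_def)
    show "regular_point mbody x" if "lev 0 1 0 (- t) x = 0" "0 < lev 1 (- 4) 0 0 x"
      "0 < lev (- 1) 5 0 0 x" "0 < \<sigma> * azi x" for x
      using outer_normal_hyp(1)[of x s t] that level_lit[OF l(2)] l(2)
      by (auto simp: lev_def in_cone_def regular_point_def level_iff)
  qed (use l(2) in \<open>auto simp: l(1) level_iff hyp_face_def closed_cone_def lev_def\<close>)
qed

lemma good_cone_face_4: "l \<in> level \<Longrightarrow> good_piece (cone_face_4 l)"
proof -
  assume "l \<in> level"
  then obtain s \<sigma> t where l: "l = (s, \<sigma>, t)" "(s, \<sigma>, t) \<in> level" by (metis prod_cases3)
  show ?thesis
  proof (rule good_piece_side[of _ 1 "- 4" 0 1 0 "- t" 0 "- 1" t \<sigma>])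
    show "cone_face_4 l = {x. lev 1 (- 4) 0 0 x = 0 \<and> 0 \<le> lev 1 0 0 (- t) x \<and> 0 \<le> lev 0 (- 1) 0 t x \<and> 0 \<le> \<sigma> * azi x}"
      by (auto simp: l(1) cone_face_4_def lev_def)
    show "regular_point mbody x" if "lev 1 (- 4) 0 0 x = 0" "0 < lev 1 0 0 (- t) x"
      "0 < lev 0 (- 1) 0 t x" "0 < \<sigma> * azi x" for x
      using regular_point_cone_face[of s x t] that level_lit[OF l(2)] l(2)
      by (auto simp: lev_def level_iff)
  qed (use l(2) in \<open>auto simp: l(1) level_iff cone_face_4_def closed_cone_def lev_def\<close>)
qed

lemma good_cone_face_5: "l \<in> level \<Longrightarrow> good_piece (cone_face_5 l)"
proof -
  assume "l \<in> level"
  then obtain s \<sigma> t where l: "l = (s, \<sigma>, t)" "(s, \<sigma>, t) \<in> level" by (metis prod_cases3)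
  show ?thesis
  proof (rule good_piece_side[of _ 1 "- 5" 0 1 0 "- t" 0 "- 1" t \<sigma>])
    show "cone_face_5 l = {x. lev 1 (- 5) 0 0 x = 0 \<and> 0 \<le> lev 1 0 0 (- t) x \<and> 0 \<le> lev 0 (- 1) 0 t x \<and> 0 \<le> \<sigma> * azi x}"
      by (auto simp: l(1) cone_face_5_def lev_def)
    show "regular_point mbody x" if "lev 1 (- 5) 0 0 x = 0" "0 < lev 1 0 0 (- t) x"
      "0 < lev 0 (- 1) 0 t x" "0 < \<sigma> * azi x" for x
      using regular_point_cone_face[of s x t] that level_lit[OF l(2)] l(2)
      by (auto simp: lev_def level_iff)
  qed (use l(2) in \<open>auto simp: l(1) level_iff cone_face_5_def closed_cone_def lev_def\<close>)
qed

lemma good_interface: "good_piece (interface i)"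
proof -
  consider "i = 0" | "i = 1" | "i = 2" | "3 \<le> i" by linarith
  then show ?thesis
  proof cases
    case 1
    show ?thesis
      by (rule good_piece_interface[of _ 1 0 "- 1" "- 1" 0 2 "- 1"])
        (auto simp: 1 interface_def lev_def closed_cone_def in_cone_def mbody_def double_mirror_defs)
  next
    case 2
    show ?thesis
      by (rule good_piece_interface[of _ 0 1 "- 1" "- 1" 0 6 1])
        (auto simp: 2 interface_def lev_def closed_cone_def in_cone_def mbody_def double_mirror_defs)
  next
    case 3
    show ?thesis
      by (rule good_piece_interface[of _ 0 1 "- 2" "- 1" 0 12 "- 1"])
        (auto simp: 3 interface_def lev_def closed_cone_def in_cone_def mbody_def double_mirror_defs)
  next
    case 4
    then have "i \<noteq> 0" "i \<noteq> 1" "i \<noteq> 2" by auto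
    then show ?thesis
      by - (rule good_piece_interface[of _ 0 1 "- 6" 0 "- 1" 12 1],
        auto simp: interface_def lev_def closed_cone_def in_cone_def mbody_def double_mirror_defs)
  qed
qed

text \<open>The point with \<open>ell = A\<close> and \<open>hyp = G\<close> in the meridian half-plane of \<open>y\<close>.\<close>

definition polar :: "real \<Rightarrow> real \<Rightarrow> 'a \<Rightarrow> 'a" where
  "polar A G y = (2 / 3 * (A + G)) *\<^sub>R e + (sqrt ((4 * A\<^sup>2 - G\<^sup>2) / 3) / norm y) *\<^sub>R y"

lemma polar_radicand: "0 < G \<Longrightarrow> G < 2 * A \<Longrightarrow> 0 < (4 * A\<^sup>2 - G\<^sup>2) / (3::real)"
  using power_strict_mono[of G "2 * A" 2] by (simp add: power_mult_distrib)

lemma polar: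
  assumes "0 < G" "G < 2 * A" "y \<noteq> 0" "y \<bullet> e = 0"
  shows "ell (polar A G y) = A" "hyp (polar A G y) = G" "sgn (azi (polar A G y)) = sgn (azi y)"
proof -
  \<comment> \<open>The distance from the axis: its square is the difference of the squares of norm
    and axial component, both expressed through A and G.\<close>
  define r where "r = sqrt ((4 * A\<^sup>2 - G\<^sup>2) / 3)"
  have r: "0 < r" "r\<^sup>2 = (4 * A\<^sup>2 - G\<^sup>2) / 3"
    using polar_radicand[OF assms(1,2)] by (auto simp: r_def)
  have inn: "polar A G y \<bullet> e = 2 / 3 * (A + G)"
    using assms by (simp add: polar_def inner_add_left ee)
  have "(norm (polar A G y))\<^sup>2 = (2 / 3 * (A + G))\<^sup>2 + r\<^sup>2"
    using assms(3) unfolding polar_def r_def[symmetric] power2_norm_eq_inner inner_add_left inner_add_right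
      inner_scaleR_left inner_scaleR_right ee inner_commute[of e y] assms(4)
    by (simp add: power2_eq_square dot_square_norm)
  also have "\<dots> = ((4 * A + G) / 3)\<^sup>2"
    unfolding r by (simp add: power2_eq_square field_simps)
  finally have "norm (polar A G y) = (4 * A + G) / 3"
    by (rule power2_eq_imp_eq) (use assms in auto)
  then show "ell (polar A G y) = A" "hyp (polar A G y) = G"
    using inn by (simp_all add: ell_def hyp_def field_simps)
  have "0 < r / norm y" using r assms by simp
  moreover have "sgn (k\<^sup>2 * z) = sgn z" if "0 < k" for k z :: real
    using that by (simp add: sgn_mult power2_eq_square)
  ultimately show "sgn (azi (polar A G y)) = sgn (azi y)"
    unfolding polar_def azi_plane r_def[symmetric] by blast
qed

lemma polar_ell_hyp:
  assumes "0 < hyp x" "hyp x < 2 * ell x"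
  defines "y \<equiv> x - (x \<bullet> e) *\<^sub>R e"
  shows "polar (ell x) (hyp x) y = x" "y \<noteq> 0" "y \<bullet> e = 0"
proof -
  show y: "y \<noteq> 0" "y \<bullet> e = 0"
    using orth_part[OF assms(1,2)] by (auto simp: y_def inner_diff_left ee)
  have "(norm y)\<^sup>2 = (norm x)\<^sup>2 - (x \<bullet> e)\<^sup>2"
    unfolding y_def power2_norm_eq_inner inner_diff_left inner_diff_right inner_scaleR_left inner_scaleR_right ee
    by (simp add: power2_eq_square inner_commute[of e x])
  also have "\<dots> = (4 * (ell x)\<^sup>2 - (hyp x)\<^sup>2) / 3"
    unfolding norm_eq[of x] inner_e_eq[of x] by (simp add: power2_eq_square field_simps)
  finally have "sqrt ((4 * (ell x)\<^sup>2 - (hyp x)\<^sup>2) / 3) = norm y" by (metis norm_ge_zero real_sqrt_unique)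
  then show "polar (ell x) (hyp x) y = x"
    using y unfolding polar_def by (simp add: inner_e_eq[symmetric]) (simp add: y_def inner_e_eq)
qed

section \<open>Meridian sections, closure and frontier\<close>

definition quad :: "real \<Rightarrow> (real \<times> real) set" where
  "quad t = {(A, G). t < A \<and> G < t \<and> 4 * G < A \<and> A < 5 * G}"

lemma quadD: "(A, G) \<in> quad t \<Longrightarrow> 0 < G \<and> G < 2 * A"
  by (auto simp: quad_def)

lemma polar_in_mbody:
  assumes l: "(s, \<sigma>, t) \<in> level" "0 < \<sigma> * azi y" and AG: "(A, G) \<in> quad t" and y: "y \<bullet> e = 0"
  shows "polar A G y \<in> mbody"
proof -
  have y0: "y \<noteq> 0" using l(2) by (auto simp: azi_def)
  note P = polar[OF conjunct1[OF quadD[OF AG]] conjunct2[OF quadD[OF AG]] y0 y]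
  have "0 < azi (polar A G y) \<longleftrightarrow> 0 < azi y" "azi (polar A G y) < 0 \<longleftrightarrow> azi y < 0"
    using P(3) by (metis sgn_greater, metis sgn_less)
  then have "0 < \<sigma> * azi (polar A G y)" using l by (auto simp: level_iff)
  then have "lit s (polar A G y)" by (rule level_lit[OF l(1)])
  moreover have "in_cone (polar A G y)" "double_mirror s (polar A G y)"
    using AG l(1) by (auto simp: in_cone_def double_mirror_defs P quad_def level_iff)
  ultimately show ?thesis using mbody_lit by blast
qed

lemma continuous_on_polar:
  assumes "continuous_on T A" "continuous_on T G" "continuous_on T y" "\<And>z. z \<in> T \<Longrightarrow> y z \<noteq> 0"
  shows "continuous_on T (\<lambda>z. polar (A z) (G z) (y z))"
  unfolding polar_def using assms by (intro continuous_intros) auto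

text \<open>Moving \<open>(ell, hyp)\<close> towards an interior point of its polygon and stretching the
  component along \<open>e'\<close> leads from a point of the closed piece into the body.\<close>

lemma in_closure_mbody:
  assumes x: "closed_cone x" "t \<le> ell x" "hyp x \<le> t" and l: "(s, \<sigma>, t) \<in> level" and Q: "0 \<le> \<sigma> * azi x"
  shows "x \<in> closure mbody"
proof -
  have t0: "0 < t" and \<sigma>: "\<sigma> = 1 \<or> \<sigma> = - 1" using l by (auto simp: level_iff)
  have h: "0 < hyp x" "hyp x < 2 * ell x" using x t0 by (auto simp: closed_cone_def)
  define y where "y = x - (x \<bullet> e) *\<^sub>R e"
  note P = polar_ell_hyp[OF h, folded y_def]
  define v where "v = y \<bullet> e'"
  \<comment> \<open>For \<sigma> = -1 this shrinks the component along e' instead, which pushes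
    \<open>azi\<close> to the negative side.\<close>
  define yd where "yd = (\<lambda>\<delta>::real. y + (\<sigma> * \<delta> * v) *\<^sub>R e')"
  \<comment> \<open>The target (9 / 4 t, 1 / 2 t) is a point of \<open>quad t\<close>, with ell /
    hyp = 9 / 2.\<close>
  define Ad where "Ad = (\<lambda>\<delta>::real. (1 - \<delta>) * ell x + \<delta> * (9 / 4 * t))"
  define Gd where "Gd = (\<lambda>\<delta>::real. (1 - \<delta>) * hyp x + \<delta> * (1 / 2 * t))"
  define xd where "xd = (\<lambda>\<delta>. polar (Ad \<delta>) (Gd \<delta>) (yd \<delta>))"
  have ye: "yd \<delta> \<bullet> e = 0" for \<delta> using P(3) by (simp add: yd_def inner_add_left ee)
  have aziy: "0 \<le> \<sigma> * azi y"
  proof -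
    have "azi (y + (x \<bullet> e) *\<^sub>R e) = azi y" using azi_plane[of "x \<bullet> e" 1 y] by (simp add: add.commute)
    then show ?thesis using Q by (simp add: y_def)
  qed
  have azi0: "azi z = 4 * (z \<bullet> e')\<^sup>2 - z \<bullet> z" if "z \<bullet> e = 0" for z
    using that by (simp add: azi_def power2_norm_eq_inner)
  have azid: "azi (yd \<delta>) = azi y + 6 * \<sigma> * \<delta> * v\<^sup>2 + 3 * \<delta>\<^sup>2 * v\<^sup>2" for \<delta>
  proof -
    have "yd \<delta> \<bullet> e' = (1 + \<sigma> * \<delta>) * v" by (simp add: yd_def inner_add_left ee v_def algebra_simps)
    moreover have "yd \<delta> \<bullet> yd \<delta> = y \<bullet> y + 2 * \<sigma> * \<delta> * v\<^sup>2 + \<delta>\<^sup>2 * v\<^sup>2"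
      using \<sigma> by (auto simp: yd_def inner_add_left inner_add_right ee v_def inner_commute[of e' y]
          power2_eq_square algebra_simps)
    ultimately show ?thesis
      using \<sigma> unfolding azi0[OF ye] azi0[OF P(3)] v_def[symmetric]
      by (auto simp: power2_eq_square algebra_simps)
  qed
  have lit: "0 < \<sigma> * azi (yd \<delta>)" if \<delta>: "0 < \<delta>" "\<delta> < 1" for \<delta>
  proof (cases "v = 0")
    \<comment> \<open>Without a component along e' the change of yd has no effect, but then
      \<open>azi y\<close> is already negative and \<sigma> must be -1.\<close>
    case True
    then have "azi y < 0" using azi0[OF P(3)] P(2) by (simp add: v_def)
    then show ?thesis using aziy \<sigma> azid[of \<delta>] True by auto
  next
    case False
    then have v2: "0 < v\<^sup>2" by simp
    have "\<delta> * v\<^sup>2 > 0" "\<delta> * (\<delta> * v\<^sup>2) < \<delta> * v\<^sup>2" "0 < \<delta> * (\<delta> * v\<^sup>2)" using \<delta> v2 by auto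
    then show ?thesis
      using aziy \<sigma> azid[of \<delta>] by (auto simp: power2_eq_square[of \<delta>] mult.assoc)
  qed
  have AG: "(Ad \<delta>, Gd \<delta>) \<in> quad t" if \<delta>: "0 < \<delta>" "\<delta> < 1" for \<delta>
  proof -
    have c: "0 < (1 - \<delta>) * a + \<delta> * b" if "0 \<le> a" "0 < b" for a b
      using that \<delta> by (intro add_nonneg_pos) auto
    have "0 < (1 - \<delta>) * (ell x - t) + \<delta> * (5 / 4 * t)" "0 < (1 - \<delta>) * (t - hyp x) + \<delta> * (1 / 2 * t)"
      "0 < (1 - \<delta>) * (ell x - 4 * hyp x) + \<delta> * (1 / 4 * t)"
      "0 < (1 - \<delta>) * (5 * hyp x - ell x) + \<delta> * (1 / 4 * t)"
      using x t0 c[of "ell x - t" "5 / 4 * t"] c[of "t - hyp x" "1 / 2 * t"]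
        c[of "ell x - 4 * hyp x" "1 / 4 * t"] c[of "5 * hyp x - ell x" "1 / 4 * t"]
      by (auto simp: closed_cone_def)
    then show ?thesis by (simp add: quad_def Ad_def Gd_def algebra_simps)
  qed
  have "xd \<delta> \<in> mbody" if "0 < \<delta>" "\<delta> < 1" for \<delta>
    unfolding xd_def by (rule polar_in_mbody[OF l lit[OF that] AG[OF that] ye])
  then have ev: "eventually (\<lambda>\<delta>. xd \<delta> \<in> closure mbody) (at_right 0)"
    using closure_subset by (intro eventually_at_rightI[of 0 1]) auto
  have "((\<lambda>\<delta>. xd \<delta>) \<longlongrightarrow> xd 0) (at_right 0)"
  proof -
    have "yd 0 \<noteq> 0" using P(2) by (simp add: yd_def)
    then have "isCont xd 0"
      unfolding xd_def polar_def Ad_def Gd_def yd_def by (intro continuous_intros) auto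
    then show ?thesis by (simp add: isCont_def filterlim_at_split)
  qed
  moreover have "xd 0 = x" using P(1) by (simp add: xd_def Ad_def Gd_def yd_def)
  ultimately show ?thesis using Lim_in_closed_set[OF closed_closure ev] by simp
qed

definition closed_double :: "real \<Rightarrow> 'a \<Rightarrow> bool" where
  "closed_double s x \<longleftrightarrow> s \<le> ell x \<and> hyp x \<le> s \<or> 6 * s \<le> ell x \<and> hyp x \<le> 6 * s"

definition closed_body :: "'a set" where
  "closed_body = {x. closed_cone x \<and> (0 \<le> azi x \<and> closed_double 1 x \<or> azi x \<le> 0 \<and> closed_double 2 x)}"

lemma closure_mbody: "closure mbody = closed_body"
proof
  show "closure mbody \<subseteq> closed_body"
  proof (rule closure_minimal)
    show "mbody \<subseteq> closed_body"
      unfolding mbody_def closed_body_def double_mirror_defs closed_double_def in_cone_def closed_cone_def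
      by auto
    show "closed closed_body"
      unfolding closed_body_def closed_double_def closed_cone_def
      by (intro closed_Collect_conj closed_Collect_disj closed_Collect_le continuous_intros)
  qed
  show "closed_body \<subseteq> closure mbody"
  proof
    fix x assume "x \<in> closed_body"
    then have "closed_cone x" and "\<exists>(s, \<sigma>, t)\<in>level. t \<le> ell x \<and> hyp x \<le> t \<and> 0 \<le> \<sigma> * azi x"
      by (auto simp: closed_body_def closed_double_def level_def)
    then show "x \<in> closure mbody" using in_closure_mbody by blast
  qed
qed

definition faces :: "'a set set" where
  "faces = ell_face ` level \<union> hyp_face ` level \<union> cone_face_4 ` level \<union> cone_face_5 ` level \<union>
     interface ` {..3}"

lemma frontier_mbody: "frontier mbody = \<Union>faces"
proof -
  have "frontier mbody = closed_body - mbody"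
    by (simp add: frontier_def closure_mbody interior_open[OF open_mbody])
  moreover have "x \<in> closed_body - mbody \<longleftrightarrow> x \<in> \<Union>faces" for x
  proof -
    have lt: "{..3} = {0, 1, 2, 3::nat}" by auto
    show ?thesis
      \<comment> \<open>With all levels spelled out, both sides are Boolean combinations of linear
        inequalities between the three numbers \<open>ell x\<close>, \<open>hyp x\<close> and
        \<open>azi x\<close>.\<close>
      unfolding faces_def lt level_def
      by (simp add: closed_body_def closed_double_def closed_cone_def mbody_def in_cone_def double_mirror_defs
          ell_face_def hyp_face_def cone_face_4_def cone_face_5_def interface_def) argo
  qed
  ultimately show ?thesis by blast
qed

lemma piecewise_smooth_mbody: "piecewise_smooth_boundary mbody"
  unfolding piecewise_smooth_boundary_def
proof (intro exI conjI)
  show "finite faces" by (auto simp: faces_def level_def)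
  show "frontier mbody = \<Union>faces" by (rule frontier_mbody)
  have "good_piece S" if "S \<in> faces" for S
    using that good_ell_face good_hyp_face good_cone_face_4 good_cone_face_5 good_interface
    by (auto simp: faces_def)
  then show "\<forall>S\<in>faces. smooth_piece S \<and> (\<forall>p\<in>S. hypersurface_corner_at 0 S p \<longrightarrow> regular_point mbody p)"
    by (simp add: good_piece_def)
qed

lemma azi_e': "azi e' = 3"
  by (simp add: azi_def ee norm_e')

lemma body_mbody: "body mbody"
proof -
  have "polar (9 / 4) (1 / 2) e' \<in> mbody"
    by (rule polar_in_mbody[of 1 1 1]) (auto simp: level_def azi_e' quad_def ee)
  then show ?thesis
    unfolding body_def using bounded_mbody open_mbody piecewise_smooth_mbody by auto
qed

section \<open>Connectedness\<close>

lemma connected_component_quad: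
  assumes "(s, \<sigma>, t) \<in> level" "0 < \<sigma> * azi y" "y \<bullet> e = 0" "(A, G) \<in> quad t" "(A', G') \<in> quad t"
  shows "connected_component mbody (polar A G y) (polar A' G' y)"
proof (rule connected_componentI)
  let ?T = "(\<lambda>z. polar (fst z) (snd z) y) ` quad t"
  have y0: "y \<noteq> 0" using assms(2) by (auto simp: azi_def)
  have "convex (quad t)"
  proof (rule convexI)
    fix p q and u v :: real
    assume h: "p \<in> quad t" "q \<in> quad t" "0 \<le> u" "0 \<le> v" "u + v = 1"
    have c: "0 < u * a + v * b" if "0 < a" "0 < b" for a b
      using convex_bound_lt[of "- a" 0 "- b" u v] that h(3-5) by simp
    obtain A G A' G' where pq: "p = (A, G)" "q = (A', G')" by (metis prod.exhaust)
    have u: "u = 1 - v" using h(5) by simp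
    have "0 < u * (A - t) + v * (A' - t)" "0 < u * (t - G) + v * (t - G')"
      "0 < u * (A - 4 * G) + v * (A' - 4 * G')" "0 < u * (5 * G - A) + v * (5 * G' - A')"
      using h(1,2) by (auto intro!: c simp: quad_def pq)
    then show "u *\<^sub>R p + v *\<^sub>R q \<in> quad t"
      by (simp add: quad_def pq u algebra_simps)
  qed
  moreover have "continuous_on (quad t) (\<lambda>z. polar (fst z) (snd z) y)"
    using y0 by (intro continuous_on_polar continuous_intros)
  ultimately show "connected ?T" by (intro connected_continuous_image convex_connected)
  show "?T \<subseteq> mbody" using polar_in_mbody[OF assms(1,2) _ assms(3)] by auto
  show "polar A G y \<in> ?T" "polar A' G' y \<in> ?T" using assms(4,5) by force+
qed

text \<open>A pair (A, G) in sections of both classes gives points of the body whatever the sign of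
  \<open>azi\<close>, so the half-plane may turn freely. Its directions form a punctured hyperplane,
  which is connected because the hyperplane has dimension at least 2.\<close>

lemma connected_component_ring:
  assumes dim: "3 \<le> DIM('a)" and AG: "(A, G) \<in> quad t" "(A, G) \<in> quad t'"
    and l: "(1, 1, t) \<in> level" "(2, - 1, t') \<in> level"
    and y: "y \<noteq> 0" "y \<bullet> e = 0" "y' \<noteq> 0" "y' \<bullet> e = 0"
  shows "connected_component mbody (polar A G y) (polar A G y')"
proof (rule connected_componentI)
  let ?H = "{y. e \<bullet> y = 0} - {0}"
  have "e \<noteq> 0" using norm_e by auto
  then have "aff_dim {y. e \<bullet> y = 0} \<noteq> 1" using dim by (simp add: aff_dim_hyperplane)
  then have "connected ?H" by (intro connected_punctured_convex convex_hyperplane)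
  moreover have "continuous_on ?H (polar A G)"
    by (intro continuous_on_polar continuous_intros) auto
  ultimately show "connected (polar A G ` ?H)" by (intro connected_continuous_image)
  show "polar A G ` ?H \<subseteq> mbody"
  proof
    fix x assume "x \<in> polar A G ` ?H"
    then obtain z where z: "z \<noteq> 0" "z \<bullet> e = 0" "x = polar A G z" by (auto simp: inner_commute)
    note P = polar(1,2)[OF conjunct1[OF quadD[OF AG(1)]] conjunct2[OF quadD[OF AG(1)]] z(1,2)]
    have "in_cone x" "double_mirror 1 x" "double_mirror 2 x"
      using AG l unfolding z(3) by (auto simp: in_cone_def double_mirror_defs P quad_def level_iff)
    then show "x \<in> mbody" by (simp add: mbody_def)
  qed
  show "polar A G y \<in> polar A G ` ?H" "polar A G y' \<in> polar A G ` ?H"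
    using y by (auto simp: inner_commute)
qed

lemma connected_mbody:
  assumes dim: "3 \<le> DIM('a)"
  shows "connected mbody"
proof -
  let ?C = "connected_component mbody"
  have sym: "?C a b \<Longrightarrow> ?C b a" and trans: "?C a b \<Longrightarrow> ?C b c \<Longrightarrow> ?C a c" for a b c
    by (auto intro: connected_component_sym connected_component_trans)
  have "dim {e, e'} \<le> card {e, e'}" by (intro dim_le_card') auto
  also have "\<dots> \<le> 2" by (simp add: card_insert_if)
  finally have "dim {e, e'} < DIM('a)" using dim by simp
  \<comment> \<open>A third direction, orthogonal to e and e', represents the second class, since
    \<open>azi f < 0\<close>.\<close>
  then obtain f where f: "f \<noteq> 0" "\<And>y. y \<in> span {e, e'} \<Longrightarrow> orthogonal f y"
    using orthogonal_to_subspace_exists by blast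
  have f': "f \<bullet> e = 0" "f \<bullet> e' = 0"
    using f(2)[of e] f(2)[of e'] by (auto simp: orthogonal_def span_base)
  have fneg: "azi f < 0" using f(1) f' by (simp add: azi_def)
  have e0: "e' \<noteq> 0" using norm_e' by auto
  \<comment> \<open>The coordinates are points common to \<open>quad 1\<close> and
    \<open>quad 2\<close>, to \<open>quad 2\<close> and \<open>quad 6\<close>, and to
    \<open>quad 6\<close> and \<open>quad 12\<close>, all with ell / hyp = 9 / 2.\<close>
  define r1 where "r1 = polar (27 / 10) (6 / 10)"
  define r2 where "r2 = polar (27 / 4) (3 / 2)"
  define r3 where "r3 = polar (45 / 2) 5"
  have R1: "?C (r1 y) (r1 y')" and R2: "?C (r2 y) (r2 y')" and R3: "?C (r3 y) (r3 y')"
    if "y \<noteq> 0" "y \<bullet> e = 0" "y' \<noteq> 0" "y' \<bullet> e = 0" for y y'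
    unfolding r1_def r2_def r3_def
    by (rule connected_component_ring[OF dim, of _ _ 1 2] connected_component_ring[OF dim, of _ _ 6 2]
        connected_component_ring[OF dim, of _ _ 6 12]; use that in \<open>simp add: quad_def level_def\<close>)+
  have r12: "?C (r1 y) (r2 y')" if y: "y \<noteq> 0" "y \<bullet> e = 0" "y' \<noteq> 0" "y' \<bullet> e = 0" for y y'
  proof -
    \<comment> \<open>Rings are changed inside \<open>quad 2\<close>, which is available only over
      the second class; hence the detour through the half-plane of f. The step between
      \<open>r3\<close> and \<open>r2\<close> uses \<open>quad 6\<close> over e' in the same
      way.\<close>
    have "?C (r1 f) (r2 f)"
      unfolding r1_def r2_def using fneg f'
      by (intro connected_component_quad[of 2 "- 1" 2]) (auto simp: level_def quad_def)
    with R1[OF y(1,2) f(1) f'(1)] R2[OF f(1) f'(1) y(3,4)] show ?thesis by (meson trans)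
  qed
  have r32: "?C (r3 y) (r2 y')" if y: "y \<noteq> 0" "y \<bullet> e = 0" "y' \<noteq> 0" "y' \<bullet> e = 0" for y y'
  proof -
    have "?C (r3 e') (r2 e')"
      unfolding r3_def r2_def
      by (intro connected_component_quad[of 1 1 6]) (auto simp: level_def quad_def azi_e' ee)
    with R3[OF y(1,2) e0 ee(3)] R2[OF e0 ee(3) y(3,4)] show ?thesis by (meson trans)
  qed
  have base: "?C x (r2 e')" if x: "x \<in> mbody" for x
  proof -
    have cone: "in_cone x" using x by (simp add: mbody_def)
    have h: "0 < hyp x" "hyp x < 2 * ell x" using cone cone_pos[OF cone] by (auto simp: in_cone_def)
    define y where "y = x - (x \<bullet> e) *\<^sub>R e"
    note P = polar_ell_hyp[OF h, folded y_def]
    have aziy: "sgn (azi x) = sgn (azi y)" using polar(3)[OF h P(2,3)] P(1) by simp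
    have lev: "?C (polar (ell x) (hyp x) z) (r2 e')"
      if z: "z \<noteq> 0" "z \<bullet> e = 0" "(s, \<sigma>, t) \<in> level" "0 < \<sigma> * azi z" "(ell x, hyp x) \<in> quad t" for z s \<sigma> t
    proof -
      have t: "t = 1 \<or> t = 6 \<or> t = 2 \<or> t = 12" using z(3) by (auto simp: level_def)
      have step: "?C (polar (ell x) (hyp x) z) (polar A G z)" if "(A, G) \<in> quad t" for A G
        by (rule connected_component_quad[OF z(3,4,2,5) that])
      from t show ?thesis
      proof (elim disjE)
        assume "t = 1"
        then have "?C (polar (ell x) (hyp x) z) (r1 z)" unfolding r1_def by (intro step) (simp add: quad_def)
        then show ?thesis using r12[OF z(1,2) e0 ee(3)] by (rule trans)
      next
        assume "t = 6"
        then have "?C (polar (ell x) (hyp x) z) (r2 z)" unfolding r2_def by (intro step) (simp add: quad_def)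
        then show ?thesis using R2[OF z(1,2) e0 ee(3)] by (rule trans)
      next
        assume "t = 2"
        then have "?C (polar (ell x) (hyp x) z) (r2 z)" unfolding r2_def by (intro step) (simp add: quad_def)
        then show ?thesis using R2[OF z(1,2) e0 ee(3)] by (rule trans)
      next
        assume "t = 12"
        then have "?C (polar (ell x) (hyp x) z) (r3 z)" unfolding r3_def by (intro step) (simp add: quad_def)
        then show ?thesis using r32[OF z(1,2) e0 ee(3)] by (rule trans)
      qed
    qed
    have quad: "(ell x, hyp x) \<in> quad s \<or> (ell x, hyp x) \<in> quad (6 * s)" if "double_mirror s x" for s
      using that cone by (auto simp: quad_def double_mirror_defs in_cone_def)
    consider "0 < azi x" | "azi x < 0" | "azi x = 0" by linarith
    then show ?thesis
    proof cases
      case 1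
      then have "0 < azi y" using aziy by (metis sgn_1_pos)
      moreover have "double_mirror 1 x" using 1 x by (auto simp: mbody_def)
      ultimately show ?thesis
        using quad[of 1] lev[OF P(2,3), of 1 1 1] lev[OF P(2,3), of 1 1 6] P(1) by (auto simp: level_def)
    next
      case 2
      then have "azi y < 0" using aziy by (metis sgn_1_neg)
      moreover have "double_mirror 2 x" using 2 x by (auto simp: mbody_def)
      ultimately show ?thesis
        using quad[of 2] lev[OF P(2,3), of 2 "- 1" 2] lev[OF P(2,3), of 2 "- 1" 12] P(1) by (auto simp: level_def)
    next
      case 3
      then have dm: "double_mirror 1 x" "double_mirror 2 x" using x by (auto simp: mbody_def)
      obtain t where t: "(ell x, hyp x) \<in> quad t" "(1, 1, t) \<in> level" using quad[OF dm(1)] by (auto simp: level_def)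
      obtain t' where t': "(ell x, hyp x) \<in> quad t'" "(2, - 1, t') \<in> level" using quad[OF dm(2)] by (auto simp: level_def)
      \<comment> \<open>A point on the interface belongs to sections of both classes, so it can be
        turned into the half-plane of e' first.\<close>
      have "?C (polar (ell x) (hyp x) y) (polar (ell x) (hyp x) e')"
        by (rule connected_component_ring[OF dim t(1) t'(1) t(2) t'(2) P(2,3) e0 ee(3)])
      moreover have "?C (polar (ell x) (hyp x) e') (r2 e')"
        by (rule lev[OF e0 ee(3) t(2) _ t(1)]) (simp add: azi_e')
      ultimately show ?thesis unfolding P(1) by (rule trans)
    qed
  qed
  show ?thesis
    unfolding connected_iff_connected_component using base sym trans by blast
qed

end

theorem theorem1:
  assumes "CARD('n::finite) \<ge> 2"
  shows "\<exists>B :: (real ^ 'n) set. body B \<and> (\<exists>P. P \<notin> closure B \<and> invisible_from B P) \<and>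
    (CARD('n) \<ge> 3 \<longrightarrow> connected B)"
proof -
  obtain i j :: 'n where ij: "i \<noteq> j"
    using assms by (metis card_2_iff' card_le_Suc0_iff_eq finite iso_tuple_UNIV_I not_less_eq_eq numeral_2_eq_2)
  interpret mirror_body "axis i 1 :: real ^ 'n" "axis j 1"
    by standard (use ij in \<open>auto simp: inner_axis_axis\<close>)
  show ?thesis
    using body_mbody origin_notin_closure invisible connected_mbody by (intro exI[of _ mbody]) auto
qed

end
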